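(* Let $\Gamma=(G,\omega,\ell)$ be a weighted tropical curve of genus $g$ and let $D\in\operatorname{Div}(\Gamma)$. Then: (1) the number $r_{\Gamma^\omega_\epsilon}(\iota_\epsilon(D))$ is independent of $\epsilon>0$; define $r_\Gamma(D):=r_{\Gamma^\omega_\epsilon}(\iota_\epsilon(D))$; (2) (Riemann–Roch) $r_\Gamma(D)-r_\Gamma(K_\Gamma-D)=\deg D-g+1$.
   Context: Graphs are finite and connected, loops and multiple edges allowed. A weighted tropical curve is $\Gamma=(G,\omega,\ell)$ with $\omega:V(G)\to\mathbb{Z}_{\ge0}$ and $\ell:E(G)\to\mathbb{R}_{>0}$; its genus is $g=b_1(G)+\sum_v\omega(v)$ with $b_1(G)=|E|-|V|+1$. It is pure if $\omega\equiv0$. The metric graph $(G,\ell)$ is regarded as the metric space obtained by gluing segments of length $\ell(e)$ along $G$. For a pure tropical curve, $\operatorname{Div}$ is the free abelian group on its points; a rational function is a continuous $f$ whose restriction to each edge is piecewise affine with integer slopes and finitely many pieces; $\operatorname{ord}_p f$ is the sum of the outgoing slopes of $f$ at $p$ over all segments emanating from $p$; $\operatorname{div}(f)=\sum_p\operatorname{ord}_p(f)p$; principal divisors are the $\operatorname{div}(f)$; $D\sim D'$ iff $D-D'$ is principal. With $R(D)$ the set of rational functions $f$ with $\operatorname{div}(f)+D\ge0$, the rank is $r(D)=\max\{k: R(D-E)\ne\emptyset$ for all effective $E$ of degree $k\}$ (so $r(D)=-1$ iff $R(D)=\emptyset$). For weighted $\Gamma$, $\operatorname{Div}(\Gamma)$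 is the free abelian group on the points of the metric graph $(G,\ell)$, and $K_\Gamma=\sum_{v\in V(G)}(\operatorname{val}(v)+2\omega(v)-2)v$ with $\operatorname{val}$ the valency in $G$. For $\epsilon>0$, $\Gamma^\omega_\epsilon$ is the pure tropical curve obtained from $(G,\ell)$ by attaching at each vertex $v$ exactly $\omega(v)$ loops of length $\epsilon$, and $\iota_\epsilon:\operatorname{Div}(\Gamma)\to\operatorname{Div}(\Gamma^\omega_\epsilon)$ is the natural inclusion. *)

theory Defs
  imports Complex_Main
begin

section \<open>Finite metric graphs (loops and multiple edges allowed)\<close>

text \<open>A graph with vertex set verts, edge set edges; each edge e is a segment
[0, len e] whose end 0 is glued to vertex src e and end len e to vertex tgt e.\<close>

record ('v, 'e) mgraph =
  verts :: "'v set"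
  edges :: "'e set"
  src   :: "'e \<Rightarrow> 'v"
  tgt   :: "'e \<Rightarrow> 'v"
  len   :: "'e \<Rightarrow> real"

definition adj_rel :: "('v, 'e) mgraph \<Rightarrow> ('v \<times> 'v) set" where
  "adj_rel G = {(src G e, tgt G e) | e. e \<in> edges G} \<union> {(tgt G e, src G e) | e. e \<in> edges G}"

definition wf_mgraph :: "('v, 'e) mgraph \<Rightarrow> bool" where
  "wf_mgraph G \<longleftrightarrow> finite (verts G) \<and> finite (edges G) \<and> verts G \<noteq> {}
     \<and> (\<forall>e\<in>edges G. src G e \<in> verts G \<and> tgt G e \<in> verts G \<and> len G e > 0)
     \<and> (\<forall>u\<in>verts G. \<forall>v\<in>verts G. (u, v) \<in> (adj_rel G)\<^sup>*)"

text \<open>Points of the metric graph: vertices, and interior points of edges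
(edge e at parameter t with 0 < t < len e).\<close>

datatype ('v, 'e) point = Vtx 'v | Inner 'e real

definition points :: "('v, 'e) mgraph \<Rightarrow> ('v, 'e) point set" where
  "points G = Vtx ` verts G \<union> {Inner e t | e t. e \<in> edges G \<and> 0 < t \<and> t < len G e}"

section \<open>Divisors\<close>

type_synonym ('v, 'e) divisor = "('v, 'e) point \<Rightarrow> int"

definition supp :: "('v, 'e) divisor \<Rightarrow> ('v, 'e) point set" where
  "supp D = {p. D p \<noteq> 0}"

definition is_divisor :: "('v, 'e) mgraph \<Rightarrow> ('v, 'e) divisor \<Rightarrow> bool" where
  "is_divisor G D \<longleftrightarrow> finite (supp D) \<and> supp D \<subseteq> points G"

definition deg :: "('v, 'e) divisor \<Rightarrow> int" where
  "deg D = (\<Sum>p\<in>supp D. D p)"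

definition effective :: "('v, 'e) divisor \<Rightarrow> bool" where
  "effective D \<longleftrightarrow> (\<forall>p. D p \<ge> 0)"

section \<open>Rational functions on a pure tropical curve\<close>

text \<open>Restriction of f to edge e, parametrised by [0, len e] (extended constantly outside).\<close>
definition edge_fun :: "('v, 'e) mgraph \<Rightarrow> (('v, 'e) point \<Rightarrow> real) \<Rightarrow> 'e \<Rightarrow> real \<Rightarrow> real" where
  "edge_fun G f e t =
     (if t \<le> 0 then f (Vtx (src G e))
      else if t \<ge> len G e then f (Vtx (tgt G e))
      else f (Inner e t))"

text \<open>phi is piecewise affine on [a,b] with integer slopes and finitely many pieces.\<close>
definition pw_affine_int :: "(real \<Rightarrow> real) \<Rightarrow> real \<Rightarrow> real \<Rightarrow> bool" where
  "pw_affine_int \<phi> a b \<longleftrightarrow>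
     (\<exists>(n::nat) (x::nat \<Rightarrow> real). x 0 = a \<and> x n = b \<and> (\<forall>i<n. x i < x (Suc i)) \<and>
        (\<forall>i<n. \<exists>s::int. \<forall>t\<in>{x i..x (Suc i)}. \<phi> t = \<phi> (x i) + of_int s * (t - x i)))"

text \<open>Continuity of f on the metric graph is built in: each edge function takes the
vertex values at its ends and is continuous on the closed segment.\<close>
definition rational_fun :: "('v, 'e) mgraph \<Rightarrow> (('v, 'e) point \<Rightarrow> real) \<Rightarrow> bool" where
  "rational_fun G f \<longleftrightarrow> (\<forall>e\<in>edges G. pw_affine_int (edge_fun G f e) 0 (len G e))"

definition rslope :: "(real \<Rightarrow> real) \<Rightarrow> real \<Rightarrow> real" where
  "rslope \<phi> t = (THE s. (\<phi> has_real_derivative s) (at_right t))"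

definition lslope :: "(real \<Rightarrow> real) \<Rightarrow> real \<Rightarrow> real" where
  "lslope \<phi> t = (THE s. (\<phi> has_real_derivative s) (at_left t))"

text \<open>ord_p f: sum of outgoing slopes of f at p along all emanating segments.\<close>
definition ord :: "('v, 'e) mgraph \<Rightarrow> (('v, 'e) point \<Rightarrow> real) \<Rightarrow> ('v, 'e) point \<Rightarrow> real" where
  "ord G f p = (case p of
      Inner e t \<Rightarrow> rslope (edge_fun G f e) t - lslope (edge_fun G f e) t
    | Vtx v \<Rightarrow> (\<Sum>e\<in>{e\<in>edges G. src G e = v}. rslope (edge_fun G f e) 0)
              - (\<Sum>e\<in>{e\<in>edges G. tgt G e = v}. lslope (edge_fun G f e) (len G e)))"

text \<open>R(D) = rational functions f with div(f) + D \<ge> 0.\<close>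
definition RR :: "('v, 'e) mgraph \<Rightarrow> ('v, 'e) divisor \<Rightarrow> (('v, 'e) point \<Rightarrow> real) set" where
  "RR G D = {f. rational_fun G f \<and> (\<forall>p\<in>points G. ord G f p + of_int (D p) \<ge> 0)}"

definition rank :: "('v, 'e) mgraph \<Rightarrow> ('v, 'e) divisor \<Rightarrow> int" where
  "rank G D = (if RR G D = {} then -1
     else int (GREATEST k::nat. \<forall>E. is_divisor G E \<and> effective E \<and> deg E = int k
                                 \<longrightarrow> RR G (\<lambda>p. D p - E p) \<noteq> {}))"

section \<open>Weighted tropical curves\<close>

definition genus :: "('v, 'e) mgraph \<Rightarrow> ('v \<Rightarrow> nat) \<Rightarrow> int" where
  "genus G \<omega> = int (card (edges G)) - int (card (verts G)) + 1 + (\<Sum>v\<in>verts G. int (\<omega> v))"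

definition val :: "('v, 'e) mgraph \<Rightarrow> 'v \<Rightarrow> nat" where
  "val G v = card {e\<in>edges G. src G e = v} + card {e\<in>edges G. tgt G e = v}"

definition canonical :: "('v, 'e) mgraph \<Rightarrow> ('v \<Rightarrow> nat) \<Rightarrow> ('v, 'e) divisor" where
  "canonical G \<omega> p = (case p of
      Vtx v \<Rightarrow> if v \<in> verts G then int (val G v) + 2 * int (\<omega> v) - 2 else 0
    | Inner _ _ \<Rightarrow> 0)"

text \<open>Gamma^omega_eps: attach omega(v) loops of length eps at each vertex v;
the new loops are the edges Inr (v, i) with i < omega v.\<close>
definition pure_curve :: "('v, 'e) mgraph \<Rightarrow> ('v \<Rightarrow> nat) \<Rightarrow> real \<Rightarrow> ('v, 'e + 'v \<times> nat) mgraph" where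
  "pure_curve G \<omega> \<epsilon> =
     \<lparr> verts = verts G,
       edges = Inl ` edges G \<union> {Inr (v, i) | v i. v \<in> verts G \<and> i < \<omega> v},
       src = case_sum (src G) fst,
       tgt = case_sum (tgt G) fst,
       len = case_sum (len G) (\<lambda>_. \<epsilon>) \<rparr>"

definition iota :: "('v, 'e) divisor \<Rightarrow> ('v, 'e + 'v \<times> nat) divisor" where
  "iota D p = (case p of
      Vtx v \<Rightarrow> D (Vtx v)
    | Inner (Inl e) t \<Rightarrow> D (Inner e t)
    | Inner (Inr _) _ \<Rightarrow> 0)"

end

theory Submission
  imports Defs
begin

text \<open>Rescaling the loops together with the values of a function on them keeps all slopes, which gives the
  independence of \<open>\<epsilon>\<close>. What remains is Riemann--Roch for a pure curve.

  A continuous piecewise affine function \<open>h\<close> without flat pieces orients the curve acyclically, and its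
  moderator \<open>\<nu>\<^sub>h\<close> has at each point the number of directions in which \<open>h\<close> decreases, minus one. It has degree
  \<open>g - 1\<close>, satisfies \<open>K - \<nu>\<^sub>h = \<nu>\<close> for \<open>- h\<close>, and \<open>R(\<nu>\<^sub>h)\<close> is empty. Conversely, if \<open>R(D)\<close> is empty, then
  \<open>D + div f \<le> \<nu>\<^sub>h\<close> for some \<open>f\<close> and \<open>h\<close>. Hence \<open>r(D) + 1\<close> is the minimum of the degree of the positive part of
  \<open>D + div f - \<nu>\<^sub>h\<close> over all \<open>f\<close> and \<open>h\<close>, and Riemann--Roch follows by replacing \<open>(f, h)\<close> by \<open>(- f, - h)\<close>.

  For the converse, choose a finite set of nodes that contains the support of \<open>D\<close> and let \<open>F\<close> be the largest
  real function on the nodes, normalised at a base node, whose interpolation with floor and ceiling slopes makes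
  \<open>D\<close> effective away from the base node. This is a reduced divisor, and the order in which Dhar's algorithm
  burns the nodes provides \<open>h\<close>.\<close>

section \<open>Functions on the vertices of a finite graph\<close>

text \<open>With arbitrary real lengths it is not clear that repeated chip firing stops, so the
  reduced divisor is found as an extremum: a maximum principle bounds the node values, and their
  supremum is admissible. The price is that slopes between nodes need not be integral. Using the
  floor of the outgoing slope at both ends of a segment forces a bend inside it. This bend is
  convex, so it adds a chip and cannot spoil effectivity; but the same chip stops the fire, which is
  why only segments of integral slope count in the burning order. The formula for the rank holds
  because an effective \<open>E\<close> makes \<open>R(D - E)\<close> empty iff
  \<open>E \<ge> D + div f - \<nu>\<^sub>h\<close> for some \<open>f\<close> and \<open>h\<close>,
  and the cheapest such \<open>E\<close> is the positive part of the right-hand side. Passing to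
  \<open>K - D\<close>, \<open>- f\<close>, \<open>- h\<close> negates that right-hand side
  \<open>X\<close>, and the degrees of the positive parts of \<open>X\<close> and \<open>- X\<close>
  differ by \<open>deg X = deg D - (g - 1)\<close>.\<close>

definition dslope :: "('v, 'e) mgraph \<Rightarrow> ('v \<Rightarrow> real) \<Rightarrow> 'e \<Rightarrow> real" where
  "dslope M F s = (F (tgt M s) - F (src M s)) / len M s"

text \<open>The choices of \<open>c\<close> used below: the identity gives the Laplacian,
  \<open>floor\<close> the divisor of the interpolation with floor slopes, \<open>neg\<close> the
  number of descending directions, a constant the valency. Slopes are taken outward from
  \<open>p\<close>, so a loop contributes two terms.\<close>

definition dsum :: "('v, 'e) mgraph \<Rightarrow> (real \<Rightarrow> 'a::comm_monoid_add) \<Rightarrow> ('v \<Rightarrow> real) \<Rightarrow> 'v \<Rightarrow> 'a" where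
  "dsum M c F p = (\<Sum>s\<in>{s\<in>edges M. src M s = p}. c (dslope M F s))
                + (\<Sum>s\<in>{s\<in>edges M. tgt M s = p}. c (- dslope M F s))"

lemma wf_mgraphD:
  assumes "wf_mgraph M"
  shows "finite (verts M)" "finite (edges M)" "verts M \<noteq> {}"
    "\<And>e. e \<in> edges M \<Longrightarrow> src M e \<in> verts M" "\<And>e. e \<in> edges M \<Longrightarrow> tgt M e \<in> verts M"
    "\<And>e. e \<in> edges M \<Longrightarrow> 0 < len M e"
  using assms by (auto simp: wf_mgraph_def)

lemma dsum_mono:
  fixes c c' :: "real \<Rightarrow> 'a::ordered_comm_monoid_add"
  assumes "\<And>s. s \<in> edges M \<Longrightarrow> src M s = p \<Longrightarrow> c (dslope M F s) \<le> c' (dslope M F' s)"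
    and "\<And>s. s \<in> edges M \<Longrightarrow> tgt M s = p \<Longrightarrow> c (- dslope M F s) \<le> c' (- dslope M F' s)"
  shows "dsum M c F p \<le> dsum M c' F' p"
  unfolding dsum_def by (intro add_mono sum_mono) (use assms in auto)

lemma dsum_floor_mono:
  assumes "wf_mgraph M" "\<And>q. q \<in> verts M \<Longrightarrow> F q - F p \<le> F' q - F' p"
  shows "dsum M floor F p \<le> dsum M floor F' p"
proof (rule dsum_mono)
  fix s assume s: "s \<in> edges M"
  note w = wf_mgraphD[OF assms(1)]
  show "\<lfloor>dslope M F s\<rfloor> \<le> \<lfloor>dslope M F' s\<rfloor>" if "src M s = p"
    unfolding dslope_def that using assms(2)[OF w(5)[OF s]] w(6)[OF s]
    by (intro floor_mono divide_right_mono) auto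
  show "\<lfloor>- dslope M F s\<rfloor> \<le> \<lfloor>- dslope M F' s\<rfloor>" if "tgt M s = p"
    unfolding dslope_def that minus_divide_left using assms(2)[OF w(4)[OF s]] w(6)[OF s]
    by (intro floor_mono divide_right_mono) auto
qed

text \<open>Each edge is met once from its source and once from its target. For the identity the two
  terms cancel, which gives degree zero; for \<open>neg\<close> and a nonzero slope they add up to
  one.\<close>

lemma sum_dsum:
  assumes "wf_mgraph M"
  shows "(\<Sum>p\<in>verts M. dsum M c F p) = (\<Sum>s\<in>edges M. c (dslope M F s) + c (- dslope M F s))"
proof -
  note w = wf_mgraphD[OF assms]
  show ?thesis unfolding dsum_def sum.distrib
    by (subst (1 2) sum.group) (use w in auto)
qed

lemma dsum_of_int_floor:
  "real_of_int (dsum M floor F p) = dsum M (\<lambda>s. of_int \<lfloor>s\<rfloor>) F p"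
  by (simp add: dsum_def)

lemma dsum_floor_le: "real_of_int (dsum M floor F p) \<le> dsum M (\<lambda>s. s) F p"
  unfolding dsum_of_int_floor by (rule dsum_mono) auto

lemma dsum_id_add_scale:
  "dsum M (\<lambda>s. s) (\<lambda>q. F q + k * b q) p = dsum M (\<lambda>s. s) F p + k * dsum M (\<lambda>s. s) b p"
proof -
  have *: "dslope M (\<lambda>q. F q + k * b q) s = dslope M F s + k * dslope M b s" for s
    by (simp add: dslope_def add_divide_distrib diff_divide_distrib algebra_simps)
  show ?thesis unfolding dsum_def *
    by (simp add: sum.distrib sum_distrib_left right_diff_distrib sum_subtractf sum_negf)
qed

section \<open>Connectedness and strictly subharmonic barriers\<close>

lemma crossing_edge:
  assumes "wf_mgraph M" "B \<subseteq> verts M" "B \<noteq> {}" "B \<noteq> verts M"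
  obtains s where "s \<in> edges M" "src M s \<in> B \<and> tgt M s \<notin> B \<or> tgt M s \<in> B \<and> src M s \<notin> B"
proof (rule ccontr)
  assume a: "\<not> thesis"
  obtain u where u: "u \<in> B" using assms by auto
  obtain v where v: "v \<in> verts M" "v \<notin> B" using assms by auto
  have "(u, v) \<in> (adj_rel M)\<^sup>*" using assms u v by (auto simp: wf_mgraph_def)
  then have "v \<in> B" using u
  proof (induction rule: rtrancl_induct)
    case (step y z) then show ?case using a that by (auto simp: adj_rel_def)
  qed auto
  then show False using v by auto
qed

text \<open>Vertices are added one at a time: \<open>K * b\<close> with a large \<open>K\<close> makes the Laplacian at the new vertex
  \<open>x\<close> positive, and raising the value at \<open>x\<close> can only increase the Laplacian at the old ones.\<close>
lemma barrier:
  assumes wf: "wf_mgraph M" and v0: "v0 \<in> verts M"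
  shows "\<exists>b. \<forall>p\<in>verts M - {v0}. 1 \<le> dsum M (\<lambda>s. s) b p"
proof -
  note w = wf_mgraphD[OF wf]
  have "\<exists>B b. v0 \<in> B \<and> B \<subseteq> verts M \<and> card B = Suc n \<and> (\<forall>q. (q \<in> B \<longrightarrow> 0 < b q) \<and> (q \<notin> B \<longrightarrow> b q = 0))
      \<and> (\<forall>p\<in>B - {v0}. 1 \<le> dsum M (\<lambda>s. s) b p)" if "Suc n \<le> card (verts M)" for n
    using that
  proof (induction n)
    case 0
    show ?case using v0 by (intro exI[of _ "{v0}"] exI[of _ "\<lambda>q. if q = v0 then 1 else 0"]) auto
  next
    case (Suc n)
    then obtain B b where B: "v0 \<in> B" "B \<subseteq> verts M" "card B = Suc n"
      and b: "\<And>q. q \<in> B \<Longrightarrow> 0 < b q" "\<And>q. q \<notin> B \<Longrightarrow> b q = 0"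
      and L: "\<And>p. p \<in> B - {v0} \<Longrightarrow> 1 \<le> dsum M (\<lambda>s. s) b p" by (metis Suc_leD)
    have "B \<noteq> verts M" using B Suc.prems by auto
    then obtain s where s: "s \<in> edges M"
        "src M s \<in> B \<and> tgt M s \<notin> B \<or> tgt M s \<in> B \<and> src M s \<notin> B"
      using crossing_edge[OF wf, of B] B by blast
    obtain x where x: "x \<in> verts M" "x \<notin> B"
      "src M s \<in> B \<and> tgt M s = x \<or> tgt M s \<in> B \<and> src M s = x" using s w by blast
    have b0: "0 \<le> b q" for q using b[of q] by (cases "q \<in> B") auto
    have bx: "b x = 0" using b x by auto
    \<comment> \<open>\<open>b\<close> vanishes at \<open>x\<close>, is nowhere negative and is
      positive at the other end of \<open>s\<close>; hence no outgoing slope at \<open>x\<close> is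
      negative and the one along \<open>s\<close> is positive.\<close>
    have pos: "0 < dsum M (\<lambda>s. s) b x"
    proof -
      have sl: "0 \<le> dslope M b t" if "t \<in> edges M" "src M t = x" for t
        using that w(6)[of t] b0 bx by (auto simp: dslope_def)
      have sr: "0 \<le> - dslope M b t" if "t \<in> edges M" "tgt M t = x" for t
        using that w(6)[of t] b0 bx by (auto simp: dslope_def)
      from x(3) show ?thesis
      proof
        assume a: "tgt M s \<in> B \<and> src M s = x"
        have "0 < (\<Sum>t\<in>{t\<in>edges M. src M t = x}. dslope M b t)"
          by (rule sum_pos2[of _ s]) (use w s a sl b bx in \<open>auto simp: dslope_def\<close>)
        moreover have "0 \<le> (\<Sum>t\<in>{t\<in>edges M. tgt M t = x}. - dslope M b t)"
          using sr by (auto intro!: sum_nonneg)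
        ultimately show ?thesis by (simp add: dsum_def)
      next
        assume a: "src M s \<in> B \<and> tgt M s = x"
        have "0 < (\<Sum>t\<in>{t\<in>edges M. tgt M t = x}. - dslope M b t)"
          by (rule sum_pos2[of _ s]) (use w s a sr b bx in \<open>auto simp: dslope_def divide_neg_pos\<close>)
        moreover have "0 \<le> (\<Sum>t\<in>{t\<in>edges M. src M t = x}. dslope M b t)"
          using sl by (auto intro!: sum_nonneg)
        ultimately show ?thesis by (simp add: dsum_def)
      qed
    qed
    define i where "i = (\<lambda>q. if q = x then 1 else 0 :: real)"
    \<comment> \<open>The fraction solves \<open>dsum i x + K * dsum b x = 1\<close> for the
      identity, and \<open>K \<ge> 1\<close> preserves the lower bound at the old vertices.\<close>
    define K where "K = max 1 ((1 - dsum M (\<lambda>s. s) i x) / dsum M (\<lambda>s. s) b x)"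
    define b' where "b' = (\<lambda>q. i q + K * b q)"
    have K1: "1 \<le> K" by (simp add: K_def)
    have e: "dsum M (\<lambda>s. s) b' p = dsum M (\<lambda>s. s) i p + K * dsum M (\<lambda>s. s) b p" for p
      unfolding b'_def by (rule dsum_id_add_scale)
    have "1 \<le> dsum M (\<lambda>s. s) b' p" if p: "p \<in> insert x B - {v0}" for p
    proof (cases "p = x")
      case True
      have "(1 - dsum M (\<lambda>s. s) i x) / dsum M (\<lambda>s. s) b x \<le> K" by (simp add: K_def)
      then show ?thesis using pos True by (simp add: e pos_divide_le_eq algebra_simps)
    next
      case False
      have "0 \<le> dsum M (\<lambda>s. s) i p" unfolding dsum_def
        using False w(6) by (intro add_nonneg_nonneg sum_nonneg)
          (auto simp: dslope_def i_def divide_le_0_iff less_imp_le)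
      moreover have "1 * 1 \<le> K * dsum M (\<lambda>s. s) b p" using L[of p] p False K1 by (intro mult_mono) auto
      ultimately show ?thesis by (simp add: e)
    qed
    moreover have "card (insert x B) = Suc (Suc n)" using x B w finite_subset[of B] by auto
    moreover have "(q \<in> insert x B \<longrightarrow> 0 < b' q) \<and> (q \<notin> insert x B \<longrightarrow> b' q = 0)" for q
      using b[of q] K1 bx by (auto simp: b'_def i_def)
    ultimately show ?case using B x by (intro exI[of _ "insert x B"] exI[of _ b']) auto
  qed
  from this[of "card (verts M) - 1"] obtain B b where
    "B \<subseteq> verts M" "card B = card (verts M)" "\<forall>p\<in>B - {v0}. 1 \<le> dsum M (\<lambda>s. s) b p"
    using w by (metis Suc_diff_1 card_gt_0_iff order_refl)
  then show ?thesis using w card_subset_eq[of "verts M" B] by blast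
qed

text \<open>The condition says that the interpolation of \<open>F\<close> by floor and ceiling slopes has \<open>div F + D \<ge> 0\<close>
  at all vertices other than \<open>v0\<close>.\<close>
definition subharm :: "('v, 'e) mgraph \<Rightarrow> 'v \<Rightarrow> ('v \<Rightarrow> int) \<Rightarrow> ('v \<Rightarrow> real) set" where
  "subharm M v0 D = {F. F v0 = 0 \<and> (\<forall>p\<in>verts M - {v0}. 0 \<le> dsum M floor F p + D p)}"

lemma subharmD:
  "F \<in> subharm M v0 D \<Longrightarrow> p \<in> verts M - {v0} \<Longrightarrow> 0 \<le> dsum M floor F p + D p"
  by (auto simp: subharm_def)

text \<open>A large multiple of the barrier outweighs both \<open>D\<close> and the loss caused by
  rounding; a constant shift makes it vanish at \<open>v0\<close>.\<close>

lemma subharm_nonempty: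
  assumes wf: "wf_mgraph M" and v0: "v0 \<in> verts M"
  shows "subharm M v0 D \<noteq> {}"
proof -
  note w = wf_mgraphD[OF wf]
  obtain b where b: "\<And>p. p \<in> verts M - {v0} \<Longrightarrow> 1 \<le> dsum M (\<lambda>s. s) b p"
    using barrier[OF assms] by blast
  \<comment> \<open>Each floor loses less than one, and no vertex has more than
    \<open>2 * card (edges M)\<close> directions. The sum pays for \<open>- D p\<close>.\<close>
  define K where "K = (\<Sum>p\<in>verts M. \<bar>real_of_int (D p)\<bar>) + 2 * card (edges M)"
  define F where "F = (\<lambda>q. - K * b v0 + K * b q)"
  have "0 \<le> dsum M floor F p + D p" if p: "p \<in> verts M - {v0}" for p
  proof -
    have K0: "0 \<le> K" by (auto simp: K_def sum_nonneg)
    have "dsum M (\<lambda>s. s) F p = dsum M (\<lambda>s. s) (\<lambda>_. - K * b v0) p + K * dsum M (\<lambda>s. s) b p"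
      unfolding F_def by (rule dsum_id_add_scale)
    also have "dsum M (\<lambda>s. s) (\<lambda>_. - K * b v0) p = 0" by (simp add: dsum_def dslope_def)
    finally have *: "K \<le> dsum M (\<lambda>s. s) F p" using b[OF p] K0 mult_left_mono[of 1 _ K] by fastforce
    have "dsum M (\<lambda>s. s) F p \<le> dsum M (\<lambda>s. of_int \<lfloor>s\<rfloor> + 1) F p"
      by (rule dsum_mono; linarith)
    also have "\<dots> = dsum M floor F p + (card {s\<in>edges M. src M s = p} + card {s\<in>edges M. tgt M s = p})"
      by (simp add: dsum_def sum.distrib)
    also have "\<dots> \<le> dsum M floor F p + 2 * card (edges M)"
      using card_mono[OF w(2), of "{s\<in>edges M. src M s = p}"]
        card_mono[OF w(2), of "{s\<in>edges M. tgt M s = p}"] by auto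
    finally have "K \<le> dsum M floor F p + 2 * card (edges M)" using * by linarith
    moreover have "\<bar>real_of_int (D p)\<bar> \<le> (\<Sum>p\<in>verts M. \<bar>real_of_int (D p)\<bar>)"
      using p w by (intro member_le_sum) auto
    ultimately have "- real_of_int (D p) \<le> dsum M floor F p" unfolding K_def by linarith
    then show ?thesis by linarith
  qed
  then have "F \<in> subharm M v0 D" by (auto simp: subharm_def F_def)
  then show ?thesis by auto
qed

text \<open>Maximum principle for \<open>F + C * b\<close>: away from \<open>v0\<close> the barrier
  makes its Laplacian positive, so the maximum is at \<open>v0\<close>, where \<open>F\<close>
  vanishes.\<close>

lemma subharm_bounded:
  assumes wf: "wf_mgraph M" and v0: "v0 \<in> verts M"
  shows "\<exists>B. \<forall>F\<in>subharm M v0 D. \<forall>p\<in>verts M. F p \<le> B p"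
proof -
  note w = wf_mgraphD[OF wf]
  obtain b where b: "\<And>p. p \<in> verts M - {v0} \<Longrightarrow> 1 \<le> dsum M (\<lambda>s. s) b p"
    using barrier[OF assms] by blast
  \<comment> \<open>The added 1 makes \<open>C\<close> strictly larger than every
    \<open>\<bar>D p\<bar>\<close>, hence the Laplacian at a maximum other than \<open>v0\<close>
    strictly positive.\<close>
  define C where "C = (\<Sum>p\<in>verts M. \<bar>real_of_int (D p)\<bar>) + 1"
  have C: "\<bar>real_of_int (D p)\<bar> < C" if "p \<in> verts M" for p
    using member_le_sum[of p "verts M" "\<lambda>p. \<bar>real_of_int (D p)\<bar>"] that w unfolding C_def by simp
  have C0: "0 \<le> C" by (auto simp: C_def sum_nonneg add_nonneg_nonneg)
  have "F q \<le> C * b v0 - C * b q" if F: "F \<in> subharm M v0 D" and q: "q \<in> verts M" for F q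
  proof -
    define H where "H = (\<lambda>q. F q + C * b q)"
    obtain p where p: "p \<in> verts M" "\<And>q. q \<in> verts M \<Longrightarrow> H q \<le> H p"
      using finite_has_maximal[of "H ` verts M"] w by force
    have "dsum M (\<lambda>s. s) H p \<le> dsum M (\<lambda>s. 0) H p"
      by (rule dsum_mono)
        (use p w in \<open>auto simp: dslope_def divide_nonpos_pos intro!: divide_nonneg_pos\<close>)
    also have "\<dots> = 0" by (simp add: dsum_def)
    finally have *: "dsum M (\<lambda>s. s) H p \<le> 0" .
    have "p = v0"
    proof (rule ccontr)
      assume "p \<noteq> v0"
      then have p': "p \<in> verts M - {v0}" using p by auto
      have "- real_of_int (D p) \<le> dsum M floor F p" using subharmD[OF F p'] by linarith
      then have "- real_of_int (D p) \<le> dsum M (\<lambda>s. s) F p"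
        using dsum_floor_le[of M F p] by linarith
      moreover have "C \<le> C * dsum M (\<lambda>s. s) b p" using b[OF p'] C0 mult_left_mono[of 1 _ C] by fastforce
      moreover have "dsum M (\<lambda>s. s) H p = dsum M (\<lambda>s. s) F p + C * dsum M (\<lambda>s. s) b p"
        unfolding H_def by (rule dsum_id_add_scale)
      ultimately show False using * C[OF p(1)] by linarith
    qed
    then have "H q \<le> H v0" using p q by auto
    then show ?thesis using F by (simp add: H_def subharm_def)
  qed
  then show ?thesis by (intro exI[of _ "\<lambda>q. C * b v0 - C * b q"]) blast
qed

text \<open>The floor is constant just to the right of \<open>x\<close>; the next integer is at
  distance \<open>1 - frac x\<close>. Here \<open>\<eta>\<close> is a change of a vertex value,
  which moves the slope along an edge of length \<open>l\<close> by
  \<open>\<eta> / l\<close>.\<close>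

lemma eventually_floor_add:
  fixes x l :: real assumes "0 < l"
  shows "eventually (\<lambda>\<eta>. \<lfloor>x + \<eta> / l\<rfloor> \<le> \<lfloor>x\<rfloor>) (at_right 0)"
proof -
  have "\<lfloor>x + y / l\<rfloor> \<le> \<lfloor>x\<rfloor>" if "y < l * (1 - frac x)" for y
  proof -
    have "y / l < 1 - frac x" using that assms by (simp add: divide_less_eq mult.commute)
    then have "x + y / l < \<lfloor>x\<rfloor> + 1" unfolding frac_def by linarith
    then show ?thesis by linarith
  qed
  moreover have "0 < l * (1 - frac x)" using assms frac_lt_1[of x] by simp
  ultimately show ?thesis unfolding eventually_at_right[OF zero_less_one] by blast
qed

text \<open>Just to the left of \<open>x\<close> the floor drops only if \<open>x\<close> is an
  integer, and then by one. A small firing move therefore costs a chip exactly in the directions of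
  integral slope.\<close>

lemma eventually_floor_diff:
  fixes x l :: real assumes "0 < l"
  shows "eventually (\<lambda>\<eta>. \<lfloor>x\<rfloor> \<le> \<lfloor>x - \<eta> / l\<rfloor> + (if x \<in> \<int> then 1 else 0)) (at_right 0)"
proof -
  define r where "r = (if x \<in> \<int> then 1 else frac x)"
  have "\<lfloor>x\<rfloor> \<le> \<lfloor>x - y / l\<rfloor> + (if x \<in> \<int> then 1 else 0)" if "y < l * r" for y
  proof -
    have "y / l < r" using that assms by (simp add: divide_less_eq mult.commute)
    then have "\<lfloor>x\<rfloor> - (if x \<in> \<int> then 1 else 0) \<le> x - y / l"
      unfolding r_def frac_def by (auto split: if_splits)
    then show ?thesis by (cases "x \<in> \<int>") (auto simp: le_floor_iff intro: order_trans[OF _ le_floor_iff[THEN iffD2]], linarith)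
  qed
  moreover have "0 < l * r" using assms by (simp add: r_def)
  ultimately show ?thesis unfolding eventually_at_right[OF zero_less_one] by blast
qed

text \<open>The pointwise supremum is again in the set because the floor function is upper semicontinuous.\<close>
lemma subharm_greatest:
  assumes wf: "wf_mgraph M" and v0: "v0 \<in> verts M"
  obtains F where "F \<in> subharm M v0 D"
    "\<And>F' p. F' \<in> subharm M v0 D \<Longrightarrow> p \<in> verts M \<Longrightarrow> F' p \<le> F p"
proof -
  note w = wf_mgraphD[OF wf]
  let ?S = "subharm M v0 D"
  obtain B where B: "\<And>F p. F \<in> ?S \<Longrightarrow> p \<in> verts M \<Longrightarrow> F p \<le> B p"
    using subharm_bounded[OF assms] by blast
  define Fs where "Fs = (\<lambda>p. SUP F\<in>?S. F p)"
  have bdd: "bdd_above ((\<lambda>F. F p) ` ?S)" if "p \<in> verts M" for p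
    using B that by (auto simp: bdd_above_def)
  have le: "F p \<le> Fs p" if "F \<in> ?S" "p \<in> verts M" for F p
    unfolding Fs_def using bdd that by (intro cSUP_upper) auto
  have "Fs v0 = (SUP F\<in>?S. 0)" unfolding Fs_def by (rule SUP_cong) (auto simp: subharm_def)
  then have 0: "Fs v0 = 0" using subharm_nonempty[OF assms] by simp
  have "0 \<le> dsum M floor Fs p + D p" if p: "p \<in> verts M - {v0}" for p
  proof -
    \<comment> \<open>\<open>\<eta>\<close> is chosen so small that raising any outgoing slope by
      \<open>\<eta> / len\<close> leaves its floor unchanged. An admissible \<open>F\<close> within
      \<open>\<eta>\<close> of the supremum at \<open>p\<close>, and below it everywhere, has
      outgoing slopes at \<open>p\<close> exceeding those of \<open>Fs\<close> by at most this
      amount.\<close>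
    have "eventually (\<lambda>\<eta>. \<forall>s\<in>edges M. \<lfloor>dslope M Fs s + \<eta> / len M s\<rfloor> \<le> \<lfloor>dslope M Fs s\<rfloor>
        \<and> \<lfloor>- dslope M Fs s + \<eta> / len M s\<rfloor> \<le> \<lfloor>- dslope M Fs s\<rfloor>) (at_right 0)"
      using w by (intro eventually_ball_finite ballI eventually_conj eventually_floor_add) auto
    then have "eventually (\<lambda>\<eta>. 0 < \<eta> \<and> (\<forall>s\<in>edges M. \<lfloor>dslope M Fs s + \<eta> / len M s\<rfloor> \<le> \<lfloor>dslope M Fs s\<rfloor>
        \<and> \<lfloor>- dslope M Fs s + \<eta> / len M s\<rfloor> \<le> \<lfloor>- dslope M Fs s\<rfloor>)) (at_right 0)"
      by (intro eventually_conj eventually_at_right_less)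
    then obtain \<eta> where \<eta>: "0 < \<eta>" "\<And>s. s \<in> edges M \<Longrightarrow> \<lfloor>dslope M Fs s + \<eta> / len M s\<rfloor> \<le> \<lfloor>dslope M Fs s\<rfloor>"
        "\<And>s. s \<in> edges M \<Longrightarrow> \<lfloor>- dslope M Fs s + \<eta> / len M s\<rfloor> \<le> \<lfloor>- dslope M Fs s\<rfloor>"
      using eventually_happens'[OF trivial_limit_at_right_real] by blast
    have "Fs p - \<eta> < (SUP F\<in>?S. F p)" using \<eta> by (simp add: Fs_def)
    then obtain F where F: "F \<in> ?S" "Fs p - \<eta> < F p"
      using less_cSUP_iff[of ?S "\<lambda>F. F p"] subharm_nonempty[OF assms] bdd[of p] p by auto
    have "dsum M floor F p \<le> dsum M floor Fs p"
    proof (rule dsum_mono)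
      fix s assume s: "s \<in> edges M"
      note l = w(6)[OF s]
      { assume a: "src M s = p"
        have "dslope M F s \<le> dslope M Fs s + \<eta> / len M s"
          unfolding dslope_def a add_divide_distrib[symmetric] using F le[OF F(1) w(5)[OF s]] l
          by (intro divide_right_mono) auto
        then show "\<lfloor>dslope M F s\<rfloor> \<le> \<lfloor>dslope M Fs s\<rfloor>" using \<eta>(2)[OF s] floor_mono order_trans by blast }
      { assume a: "tgt M s = p"
        have "- dslope M F s \<le> - dslope M Fs s + \<eta> / len M s"
          unfolding dslope_def a minus_divide_left add_divide_distrib[symmetric]
          using F le[OF F(1) w(4)[OF s]] l
          by (intro divide_right_mono) auto
        then show "\<lfloor>- dslope M F s\<rfloor> \<le> \<lfloor>- dslope M Fs s\<rfloor>" using \<eta>(3)[OF s] floor_mono order_trans by blast }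
    qed
    moreover have "0 \<le> dsum M floor F p + D p" using F p by (auto simp: subharm_def)
    ultimately show ?thesis by linarith
  qed
  then have "Fs \<in> ?S" using 0 by (auto simp: subharm_def)
  then show ?thesis using that le by blast
qed

text \<open>Otherwise raising \<open>F\<close> slightly on \<open>A\<close> would contradict its maximality.\<close>
lemma subharm_greatest_fire:
  assumes wf: "wf_mgraph M" and v0: "v0 \<in> verts M"
    and F: "F \<in> subharm M v0 D"
    and max: "\<And>F' p. F' \<in> subharm M v0 D \<Longrightarrow> p \<in> verts M \<Longrightarrow> F' p \<le> F p"
    and A: "A \<subseteq> verts M - {v0}" "A \<noteq> {}"
  obtains p where "p \<in> A"
    "dsum M floor F p + D p <
      (\<Sum>s\<in>{s\<in>edges M. src M s = p}. if dslope M F s \<in> \<int> \<and> tgt M s \<notin> A then 1 else 0)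
      + (\<Sum>s\<in>{s\<in>edges M. tgt M s = p}. if dslope M F s \<in> \<int> \<and> src M s \<notin> A then 1 else 0)"
proof (rule ccontr)
  assume a: "\<not> thesis"
  note concl = that
  note w = wf_mgraphD[OF wf]
  let ?P = "\<lambda>\<eta>. \<forall>s\<in>edges M. 
        \<lfloor>dslope M F s\<rfloor> \<le> \<lfloor>dslope M F s - \<eta> / len M s\<rfloor> + (if dslope M F s \<in> \<int> then 1 else 0)
      \<and> \<lfloor>- dslope M F s\<rfloor> \<le> \<lfloor>- dslope M F s - \<eta> / len M s\<rfloor> + (if - dslope M F s \<in> \<int> then 1 else 0)"
  have "eventually ?P (at_right 0)"
    using w by (intro eventually_ball_finite ballI eventually_conj eventually_floor_diff) auto
  then have "eventually (\<lambda>\<eta>. 0 < \<eta> \<and> ?P \<eta>) (at_right 0)"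
    by (intro eventually_conj eventually_at_right_less)
  then obtain \<eta> where \<eta>: "0 < \<eta>" "?P \<eta>"
    using eventually_happens'[OF trivial_limit_at_right_real] by blast
  \<comment> \<open>This fires \<open>A\<close> by \<open>\<eta>\<close>. Vertices outside
    \<open>A\<close> only gain. A vertex of \<open>A\<close> loses at most one chip per direction
    leaving \<open>A\<close> with integral slope, and the negated claim says that it can afford
    this.\<close>
  define F' where "F' = (\<lambda>q. if q \<in> A then F q + \<eta> else F q)"
  have "0 \<le> dsum M floor F' p + D p" if p: "p \<in> verts M - {v0}" for p
  proof (cases "p \<in> A")
    case False
    have "dsum M floor F p \<le> dsum M floor F' p"
      using False \<eta> by (intro dsum_floor_mono wf) (auto simp: F'_def)
    then show ?thesis using subharmD[OF F p] by linarith
  next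
    case True
    have "dsum M floor F p \<le> (\<Sum>s\<in>{s\<in>edges M. src M s = p}. \<lfloor>dslope M F' s\<rfloor> + (if dslope M F s \<in> \<int> \<and> tgt M s \<notin> A then 1 else 0))
      + (\<Sum>s\<in>{s\<in>edges M. tgt M s = p}. \<lfloor>- dslope M F' s\<rfloor> + (if dslope M F s \<in> \<int> \<and> src M s \<notin> A then 1 else 0))"
      unfolding dsum_def
    proof (intro add_mono sum_mono)
      fix s assume "s \<in> {s\<in>edges M. src M s = p}"
      then have s: "s \<in> edges M" "src M s = p" by auto
      have "dslope M F' s = (if tgt M s \<in> A then dslope M F s else dslope M F s - \<eta> / len M s)"
        using s True by (simp add: F'_def dslope_def diff_divide_distrib add_divide_distrib)
      then show "\<lfloor>dslope M F s\<rfloor> \<le> \<lfloor>dslope M F' s\<rfloor> + (if dslope M F s \<in> \<int> \<and> tgt M s \<notin> A then 1 else 0)"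
        using \<eta>(2) s by auto
    next
      fix s assume "s \<in> {s\<in>edges M. tgt M s = p}"
      then have s: "s \<in> edges M" "tgt M s = p" by auto
      have "- dslope M F' s = (if src M s \<in> A then - dslope M F s else - dslope M F s - \<eta> / len M s)"
        using s True by (simp add: F'_def dslope_def diff_divide_distrib add_divide_distrib)
      then show "\<lfloor>- dslope M F s\<rfloor> \<le> \<lfloor>- dslope M F' s\<rfloor> + (if dslope M F s \<in> \<int> \<and> src M s \<notin> A then 1 else 0)"
        using \<eta>(2) s minus_in_Ints_iff[of "dslope M F s"] by auto
    qed
    also have "\<dots> = dsum M floor F' p + ((\<Sum>s\<in>{s\<in>edges M. src M s = p}. if dslope M F s \<in> \<int> \<and> tgt M s \<notin> A then 1 else 0)
      + (\<Sum>s\<in>{s\<in>edges M. tgt M s = p}. if dslope M F s \<in> \<int> \<and> src M s \<notin> A then 1 else 0))"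
      by (simp add: dsum_def sum.distrib)
    finally show ?thesis using a concl[OF True] by linarith
  qed
  then have "F' \<in> subharm M v0 D" using F A by (auto simp: subharm_def F'_def)
  then show False using max[of F'] A \<eta> by (force simp: F'_def)
qed

text \<open>\<open>h\<close> is the burning time in Dhar's algorithm started at \<open>v0\<close>:
  \<open>subharm_greatest_fire\<close> applied to the set of unburnt vertices yields one with fewer
  chips than burning directions, and it burns next.\<close>

lemma burning_order:
  assumes wf: "wf_mgraph M" and v0: "v0 \<in> verts M"
    and F: "F \<in> subharm M v0 D"
    and max: "\<And>F' p. F' \<in> subharm M v0 D \<Longrightarrow> p \<in> verts M \<Longrightarrow> F' p \<le> F p"
  obtains h :: "'v \<Rightarrow> real" where "inj_on h (verts M)"
    "\<And>p. p \<in> verts M - {v0} \<Longrightarrow> dsum M floor F p + D p <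
      (\<Sum>s\<in>{s\<in>edges M. src M s = p}. if dslope M F s \<in> \<int> \<and> h (tgt M s) < h p then 1 else 0)
      + (\<Sum>s\<in>{s\<in>edges M. tgt M s = p}. if dslope M F s \<in> \<int> \<and> h (src M s) < h p then 1 else 0)"
proof -
  let ?C = "\<lambda>P p. (\<Sum>s\<in>{s\<in>edges M. src M s = p}. if dslope M F s \<in> \<int> \<and> P (tgt M s) then 1 else 0 :: int)
      + (\<Sum>s\<in>{s\<in>edges M. tgt M s = p}. if dslope M F s \<in> \<int> \<and> P (src M s) then 1 else 0)"
  note w = wf_mgraphD[OF wf]
  have mono: "?C P p \<le> ?C Q p" if "\<And>q. P q \<Longrightarrow> Q q" for P Q p
    using that by (intro add_mono sum_mono) auto
  \<comment> \<open>The induction runs over the unburnt set \<open>A\<close>; all vertices outside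
    \<open>A\<close> count as burnt at time 0. Times are distinct on \<open>A\<close> only, which
    suffices in the end, when \<open>v0\<close> alone lies outside.\<close>
  have *: "\<exists>h::'v \<Rightarrow> real. inj_on h A \<and> (\<forall>q. (q \<in> A \<longrightarrow> 0 < h q) \<and> (q \<notin> A \<longrightarrow> h q = 0))
      \<and> (\<forall>p\<in>A. dsum M floor F p + D p < ?C (\<lambda>q. h q < h p) p)"
    if "finite A" "A \<subseteq> verts M - {v0}" for A
    using that
  proof (induction A rule: finite_psubset_induct)
    case (psubset A)
    show ?case
    proof (cases "A = {}")
      case True then show ?thesis by (intro exI[of _ "\<lambda>_. 0"]) auto
    next
      case False
      obtain p where p: "p \<in> A" "dsum M floor F p + D p < ?C (\<lambda>q. q \<notin> A) p"
        using subharm_greatest_fire[OF wf v0 F _ psubset.prems False] max by blast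
      obtain h :: "'v \<Rightarrow> real" where h: "inj_on h (A - {p})" "\<And>q. q \<in> A - {p} \<Longrightarrow> 0 < h q"
        "\<And>q. q \<notin> A - {p} \<Longrightarrow> h q = 0"
        "\<And>q. q \<in> A - {p} \<Longrightarrow> dsum M floor F q + D q < ?C (\<lambda>r. h r < h q) q"
        using psubset.IH[of "A - {p}"] p psubset.prems by blast
      \<comment> \<open>\<open>p\<close> burns first among \<open>A\<close>. The other times come
        from the induction hypothesis, in which \<open>p\<close> was already burnt, and are delayed
        by one; strict comparisons survive.\<close>
      define h' where "h' = (\<lambda>q. if q \<in> A - {p} then h q + 1 else if q = p then 1 else 0 :: real)"
      have "inj_on h' A" using h(1,2) unfolding inj_on_def h'_def by (auto split: if_splits) force+
      moreover have "(q \<in> A \<longrightarrow> 0 < h' q) \<and> (q \<notin> A \<longrightarrow> h' q = 0)" for q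
        using h(2)[of q] p by (auto simp: h'_def)
      moreover have "dsum M floor F q + D q < ?C (\<lambda>r. h' r < h' q) q" if q: "q \<in> A" for q
      proof (cases "q = p")
        case True
        have "?C (\<lambda>q. q \<notin> A) p \<le> ?C (\<lambda>r. h' r < h' p) p"
          by (rule mono) (use p in \<open>auto simp: h'_def\<close>)
        then show ?thesis using p True by auto
      next
        case False
        have "?C (\<lambda>r. h r < h q) q \<le> ?C (\<lambda>r. h' r < h' q) q"
        proof (rule mono)
          fix r assume "h r < h q"
          then show "h' r < h' q" using q False h(2)[of q] h(3)[of r] by (auto simp: h'_def)
        qed
        then show ?thesis using h(4)[of q] q False by auto
      qed
      ultimately show ?thesis by blast
    qed
  qed
  have "finite (verts M - {v0})" using w by auto
  from *[OF this order_refl] obtain h :: "'v \<Rightarrow> real" where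
    h: "inj_on h (verts M - {v0})" "\<And>q. q \<in> verts M - {v0} \<Longrightarrow> 0 < h q" "\<And>q. q \<notin> verts M - {v0} \<Longrightarrow> h q = 0"
    "\<And>p. p \<in> verts M - {v0} \<Longrightarrow> dsum M floor F p + D p < ?C (\<lambda>q. h q < h p) p" by blast
  have "inj_on h (verts M)"
    using h(1-3) unfolding inj_on_def by (metis Diff_iff less_irrefl singleton_iff)
  then show ?thesis using that h(4) by blast
qed

section \<open>Subdivisions\<close>

text \<open>The gluing map of the segment \<open>[0, len e]\<close>, extended constantly to all
  reals, so that \<open>edge_fun\<close> is \<open>f\<close> composed with it.\<close>

definition pt :: "('v, 'e) mgraph \<Rightarrow> 'e \<Rightarrow> real \<Rightarrow> ('v, 'e) point" where
  "pt H e t = (if t \<le> 0 then Vtx (src H e) else if t \<ge> len H e then Vtx (tgt H e) else Inner e t)"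

lemma edge_fun_pt: "edge_fun H f e = (\<lambda>t. f (pt H e t))"
  by (auto simp: edge_fun_def pt_def)

definition subdiv :: "('v, 'e) mgraph \<Rightarrow> ('e \<Rightarrow> real set) \<Rightarrow> bool" where
  "subdiv H S \<longleftrightarrow> (\<forall>e\<in>edges H. finite (S e) \<and> S e \<subseteq> {0<..<len H e})"

text \<open>\<open>S e\<close> holds interior cut points only; the ends of the edge enter as the
  default successor \<open>len H e\<close> here and the default predecessor 0 in
  \<open>prv\<close>.\<close>

definition nxt :: "('v, 'e) mgraph \<Rightarrow> ('e \<Rightarrow> real set) \<Rightarrow> 'e \<Rightarrow> real \<Rightarrow> real" where
  "nxt H S e a = Min (insert (len H e) {b\<in>S e. a < b})"

definition prv :: "('e \<Rightarrow> real set) \<Rightarrow> 'e \<Rightarrow> real \<Rightarrow> real" where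
  "prv S e b = Max (insert 0 {a\<in>S e. a < b})"

text \<open>A segment of the subdivided curve is named by its edge and its left end.\<close>
definition model :: "('v, 'e) mgraph \<Rightarrow> ('e \<Rightarrow> real set) \<Rightarrow> (('v, 'e) point, 'e \<times> real) mgraph" where
  "model H S = \<lparr> verts = Vtx ` verts H \<union> (\<lambda>(e, t). Inner e t) ` (SIGMA e:edges H. S e),
     edges = (SIGMA e:edges H. insert 0 (S e)),
     src = (\<lambda>(e, a). pt H e a),
     tgt = (\<lambda>(e, a). pt H e (nxt H S e a)),
     len = (\<lambda>(e, a). nxt H S e a - a) \<rparr>"

lemma model_simps:
  "verts (model H S) = Vtx ` verts H \<union> (\<lambda>(e, t). Inner e t) ` (SIGMA e:edges H. S e)"
  "edges (model H S) = (SIGMA e:edges H. insert 0 (S e))"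
  "src (model H S) (e, a) = pt H e a"
  "tgt (model H S) (e, a) = pt H e (nxt H S e a)"
  "len (model H S) (e, a) = nxt H S e a - a"
  by (simp_all add: model_def)

lemma subdivD:
  assumes "subdiv H S" "e \<in> edges H"
  shows "finite (S e)" "\<And>t. t \<in> S e \<Longrightarrow> 0 < t" "\<And>t. t \<in> S e \<Longrightarrow> t < len H e"
  using assms unfolding subdiv_def by (fastforce dest: bspec)+

context
  fixes H :: "('v, 'e) mgraph" and S e
  assumes wf: "wf_mgraph H" and sd: "subdiv H S" and e: "e \<in> edges H"
begin

lemmas seg = subdivD[OF sd e]

lemma len_pos: "0 < len H e" using wf e by (auto simp: wf_mgraph_def)

lemma nxt_in: "nxt H S e a \<in> insert (len H e) {b\<in>S e. a < b}"
  unfolding nxt_def using seg by (intro Min_in) auto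

lemma nxt_gt: "a < len H e \<Longrightarrow> a < nxt H S e a"
  using nxt_in[of a] by auto

lemma nxt_gt': "a \<in> insert 0 (S e) \<Longrightarrow> a < nxt H S e a"
  using nxt_gt[of a] len_pos seg by auto

lemma nxt_le: "b \<in> insert (len H e) (S e) \<Longrightarrow> a < b \<Longrightarrow> nxt H S e a \<le> b"
  unfolding nxt_def using seg by (intro Min_le) auto

lemma nxt_le_len: "nxt H S e a \<le> len H e"
  unfolding nxt_def using seg by (intro Min_le) auto

lemma nxt_eqI:
  assumes "b \<in> insert (len H e) (S e)" "a < b" "\<And>x. x \<in> S e \<Longrightarrow> a < x \<Longrightarrow> b \<le> x"
  shows "nxt H S e a = b"
proof -
  have "b \<le> nxt H S e a" using nxt_in[of a] assms seg by (auto simp: less_imp_le)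
  then show ?thesis using nxt_le[OF assms(1,2)] by auto
qed

lemma prv_in: "prv S e b \<in> insert 0 {a\<in>S e. a < b}"
  unfolding prv_def using seg by (intro Max_in) auto

lemma prv_in': "prv S e b \<in> insert 0 (S e)" using prv_in[of b] by auto

lemma prv_lt: "0 < b \<Longrightarrow> prv S e b < b"
  using prv_in[of b] by auto

lemma prv_ge: "a \<in> insert 0 (S e) \<Longrightarrow> a < b \<Longrightarrow> a \<le> prv S e b"
  unfolding prv_def using seg by (intro Max_ge) auto

lemma prv_eqI:
  assumes "a \<in> insert 0 (S e)" "a < b" "b \<le> nxt H S e a"
  shows "prv S e b = a"
proof -
  have "prv S e b \<le> a"
  proof (rule ccontr)
    assume *: "\<not> prv S e b \<le> a"
    moreover have "0 \<le> a" using assms(1) seg by force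
    ultimately have "prv S e b \<in> S e" "prv S e b < b" using prv_in[of b] by auto
    then show False using nxt_le[of "prv S e b" a] * assms by auto
  qed
  then show ?thesis using prv_ge[OF assms(1,2)] by auto
qed

lemma le_nxt_prv: "0 < b \<Longrightarrow> b \<le> len H e \<Longrightarrow> b \<le> nxt H S e (prv S e b)"
proof (rule ccontr)
  assume a: "0 < b" "b \<le> len H e" "\<not> b \<le> nxt H S e (prv S e b)"
  then have "nxt H S e (prv S e b) \<in> S e" "nxt H S e (prv S e b) < b" 
    using nxt_in[of "prv S e b"] by auto
  then have "nxt H S e (prv S e b) \<le> prv S e b" by (intro prv_ge) auto
  then show False using nxt_gt'[OF prv_in', of b] by auto
qed

lemma nxt_prv: "b \<in> insert (len H e) (S e) \<Longrightarrow> nxt H S e (prv S e b) = b"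
  using le_nxt_prv[of b] nxt_le[of b "prv S e b"] prv_lt[of b] len_pos seg by force

lemma prv_nxt: "a \<in> insert 0 (S e) \<Longrightarrow> prv S e (nxt H S e a) = a"
  using nxt_gt' by (intro prv_eqI) auto

lemma nxt_pos: "a \<in> insert 0 (S e) \<Longrightarrow> 0 < nxt H S e a"
  using nxt_gt'[of a] seg by force

lemma pt_in_verts: "a \<in> insert 0 (insert (len H e) (S e)) \<Longrightarrow> pt H e a \<in> verts (model H S)"
  using wf e seg len_pos by (auto simp: pt_def model_simps wf_mgraph_def)

text \<open>Walk left from cut point to cut point; the number of cut points still to the left
  decreases.\<close>

lemma model_connected_src:
  "a \<in> insert 0 (S e) \<Longrightarrow> (pt H e a, Vtx (src H e)) \<in> (adj_rel (model H S))\<^sup>*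
     \<and> (Vtx (src H e), pt H e a) \<in> (adj_rel (model H S))\<^sup>*"
proof (induction "card {b\<in>S e. b < a}" arbitrary: a rule: less_induct)
  case less
  show ?case
  proof (cases "a = 0")
    case True then show ?thesis by (simp add: pt_def)
  next
    case False
    then have a: "a \<in> S e" "0 < a" using less.prems seg by auto
    let ?p = "prv S e a"
    have p: "?p \<in> insert 0 (S e)" "?p < a" using prv_in' prv_lt a by auto
    have "(pt H e a, Vtx (src H e)) \<in> (adj_rel (model H S))\<^sup>* \<and> (Vtx (src H e), pt H e a) \<in> (adj_rel (model H S))\<^sup>*"
      if "(pt H e ?p, Vtx (src H e)) \<in> (adj_rel (model H S))\<^sup>* \<and> (Vtx (src H e), pt H e ?p) \<in> (adj_rel (model H S))\<^sup>*"
    proof -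
      have n: "nxt H S e ?p = a" using nxt_prv a by auto
      have "(e, ?p) \<in> edges (model H S)" using e p by (auto simp: model_simps)
      then have "(pt H e ?p, pt H e a) \<in> adj_rel (model H S)" "(pt H e a, pt H e ?p) \<in> adj_rel (model H S)"
        unfolding adj_rel_def using n by (force simp: model_simps)+
      then show ?thesis using that by (meson converse_rtrancl_into_rtrancl rtrancl.rtrancl_into_rtrancl)
    qed
    moreover have "card {b\<in>S e. b < ?p} < card {b\<in>S e. b < a}" if "?p \<noteq> 0"
      using p that seg by (intro psubset_card_mono) auto
    moreover have "pt H e 0 = Vtx (src H e)" by (simp add: pt_def)
    ultimately show ?thesis using less.hyps[of ?p] p by (cases "?p = 0") auto
  qed
qed

lemma model_connected_tgt:
  "(Vtx (src H e), Vtx (tgt H e)) \<in> (adj_rel (model H S))\<^sup>*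
   \<and> (Vtx (tgt H e), Vtx (src H e)) \<in> (adj_rel (model H S))\<^sup>*"
proof -
  let ?p = "prv S e (len H e)"
  have n: "nxt H S e ?p = len H e" using nxt_prv by auto
  have "(e, ?p) \<in> edges (model H S)" using e prv_in' by (auto simp: model_simps)
  then have "(pt H e ?p, pt H e (len H e)) \<in> adj_rel (model H S)"
    "(pt H e (len H e), pt H e ?p) \<in> adj_rel (model H S)"
    unfolding adj_rel_def using n by (force simp: model_simps)+
  moreover have "pt H e (len H e) = Vtx (tgt H e)" using len_pos by (auto simp: pt_def)
  ultimately show ?thesis using model_connected_src[OF prv_in', of "len H e"]
    by (metis converse_rtrancl_into_rtrancl rtrancl.rtrancl_into_rtrancl)
qed

end

section \<open>The subdivided curve as a connected graph with the same Euler characteristic\<close>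

lemma wf_model:
  assumes wf: "wf_mgraph H" and sd: "subdiv H S"
  shows "wf_mgraph (model H S)"
proof -
  note w = wf_mgraphD[OF wf]
  let ?M = "model H S"
  have "finite (verts ?M)" using w subdivD[OF sd] by (auto simp: model_simps)
  moreover have "finite (edges ?M)" using w subdivD[OF sd] by (auto simp: model_simps)
  moreover have "verts ?M \<noteq> {}" using w by (auto simp: model_simps)
  moreover have "src ?M s \<in> verts ?M \<and> tgt ?M s \<in> verts ?M \<and> len ?M s > 0" if "s \<in> edges ?M" for s
  proof -
    obtain e a where s: "s = (e, a)" by force
    then have e: "e \<in> edges H" and a: "a \<in> insert 0 (S e)" using that by (auto simp: model_simps)
    show ?thesis using pt_in_verts[OF wf sd e, of a] pt_in_verts[OF wf sd e, of "nxt H S e a"]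
        nxt_in[OF wf sd e, of a] nxt_gt'[OF wf sd e a] a unfolding s model_simps by auto
  qed
  moreover have "(u, v) \<in> (adj_rel ?M)\<^sup>*" if uv: "u \<in> verts ?M" "v \<in> verts ?M" for u v
  proof -
    have V: "(Vtx x, Vtx y) \<in> (adj_rel ?M)\<^sup>*" if "x \<in> verts H" "y \<in> verts H" for x y
    proof -
      have "(x, y) \<in> (adj_rel H)\<^sup>*" using wf that by (auto simp: wf_mgraph_def)
      then show ?thesis
      proof (induction rule: rtrancl_induct)
        case (step y z)
        then have "(Vtx y, Vtx z) \<in> (adj_rel ?M)\<^sup>*"
          using model_connected_tgt[OF wf sd] by (auto simp: adj_rel_def[of H])
        then show ?case using step by auto
      qed auto
    qed
    have *: "\<exists>x\<in>verts H. (u, Vtx x) \<in> (adj_rel ?M)\<^sup>* \<and> (Vtx x, u) \<in> (adj_rel ?M)\<^sup>*" if "u \<in> verts ?M" for u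
    proof (cases u)
      case (Vtx v) then show ?thesis using that by (auto simp: model_simps)
    next
      case (Inner e t)
      then have e: "e \<in> edges H" "t \<in> S e" using that by (auto simp: model_simps)
      have "pt H e t = u" using subdivD(2,3)[OF sd e] Inner by (auto simp: pt_def)
      then show ?thesis using model_connected_src[OF wf sd e(1), of t] e w(4) by auto
    qed
    from *[OF uv(1)] *[OF uv(2)] V show ?thesis by (meson rtrancl_trans)
  qed
  ultimately show ?thesis unfolding wf_mgraph_def by blast
qed

text \<open>Every cut point adds one vertex and one edge.\<close>

lemma card_model:
  assumes wf: "wf_mgraph H" and sd: "subdiv H S"
  shows "int (card (edges (model H S))) - int (card (verts (model H S)))
    = int (card (edges H)) - int (card (verts H))"
proof -
  note w = wf_mgraphD[OF wf] and s = subdivD[OF sd]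
  have "card (edges (model H S)) = (\<Sum>e\<in>edges H. Suc (card (S e)))"
  proof -
    have "card (SIGMA e:edges H. insert 0 (S e)) = (\<Sum>e\<in>edges H. card (insert 0 (S e)))"
      using w s(1) by (intro card_SigmaI) auto
    also have "\<dots> = (\<Sum>e\<in>edges H. Suc (card (S e)))"
    proof (rule sum.cong[OF refl])
      fix e assume e: "e \<in> edges H"
      then have "0 \<notin> S e" using s(2)[OF e, of 0] by auto
      then show "card (insert 0 (S e)) = Suc (card (S e))" using s(1)[OF e] by simp
    qed
    finally show ?thesis by (simp only: model_simps)
  qed
  moreover have "card (verts (model H S)) = card (Vtx ` verts H :: ('a, 'b) point set) + card ((\<lambda>(e, t). Inner e t :: ('a, 'b) point) ` (SIGMA e:edges H. S e))"
    unfolding model_simps using w(1,2) s(1) by (subst card_Un_disjoint[symmetric]) auto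
  moreover have "card (Vtx ` verts H :: ('a, 'b) point set) = card (verts H)" by (intro card_image inj_onI) auto
  moreover have "card ((\<lambda>(e, t). Inner e t :: ('a, 'b) point) ` (SIGMA e:edges H. S e)) = (\<Sum>e\<in>edges H. card (S e))"
    using w(1,2) s(1) by (subst card_image) (auto intro!: inj_onI)
  ultimately show ?thesis by (simp add: sum_Suc)
qed

lemma verts_model_subset: "subdiv H S \<Longrightarrow> verts (model H S) \<subseteq> points H"
  using subdivD(2,3)[of H S] by (fastforce simp: model_simps points_def)

text \<open>The slope set \<open>Z\<close> lets one notion serve both kinds of functions:
  \<open>\<int>\<close> for rational functions, \<open>-{0}\<close> for the functions that orient
  the curve.\<close>

definition aff :: "('v, 'e) mgraph \<Rightarrow> ('e \<Rightarrow> real set) \<Rightarrow> real set \<Rightarrow> (('v, 'e) point \<Rightarrow> real) \<Rightarrow> bool" where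
  "aff H S Z f \<longleftrightarrow> (\<forall>e\<in>edges H. \<forall>a\<in>insert 0 (S e). \<exists>s\<in>Z. \<forall>t\<in>{a..nxt H S e a}.
     f (pt H e t) = f (pt H e a) + s * (t - a))"

lemma aff_dslope:
  assumes "wf_mgraph H" "subdiv H S" "aff H S Z f" "e \<in> edges H" "a \<in> insert 0 (S e)"
  shows "dslope (model H S) f (e, a) \<in> Z"
    "\<And>t. a \<le> t \<Longrightarrow> t \<le> nxt H S e a \<Longrightarrow> f (pt H e t) = f (pt H e a) + dslope (model H S) f (e, a) * (t - a)"
proof -
  obtain s where s: "s \<in> Z" "\<And>t. a \<le> t \<Longrightarrow> t \<le> nxt H S e a \<Longrightarrow> f (pt H e t) = f (pt H e a) + s * (t - a)"
    using assms unfolding aff_def by (meson atLeastAtMost_iff)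
  have "a < nxt H S e a" using nxt_gt'[OF assms(1,2,4,5)] .
  then have d: "dslope (model H S) f (e, a) = s"
    using s(2)[of "nxt H S e a"] by (simp add: dslope_def model_simps)
  show "dslope (model H S) f (e, a) \<in> Z" using d s(1) by simp
  show "\<And>t. a \<le> t \<Longrightarrow> t \<le> nxt H S e a \<Longrightarrow> f (pt H e t) = f (pt H e a) + dslope (model H S) f (e, a) * (t - a)"
    unfolding d by (rule s(2))
qed

lemma aff_mono: "aff H S Z f \<Longrightarrow> Z \<subseteq> Z' \<Longrightarrow> aff H S Z' f"
  unfolding aff_def by blast

lemma aff_refine:
  assumes wf: "wf_mgraph H" and sd: "subdiv H S" "subdiv H S'" and sub: "\<And>e. S e \<subseteq> S' e" and f: "aff H S Z f"
  shows "aff H S' Z f"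
  unfolding aff_def
proof (intro ballI)
  fix e a assume e: "e \<in> edges H" and a: "a \<in> insert 0 (S' e)"
  define n where "n = nxt H S' e a"
  have n: "a < n" "n \<le> len H e" "0 < n"
    unfolding n_def using nxt_gt'[OF wf sd(2) e a] nxt_le_len[OF wf sd(2) e] nxt_pos[OF wf sd(2) e a] by auto
  \<comment> \<open>\<open>b\<close> is the left end of the coarse segment that contains the fine
    segment \<open>[a, n]\<close>.\<close>
  define b where "b = prv S e n"
  have b: "b \<in> insert 0 (S e)" "b < n" using prv_in'[OF wf sd(1) e] prv_lt[OF wf sd(1) e n(3)] by (auto simp: b_def)
  have nb: "n \<le> nxt H S e b" unfolding b_def by (rule le_nxt_prv[OF wf sd(1) e n(3,2)])
  have ba: "b \<le> a"
  proof (rule ccontr)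
    assume *: "\<not> b \<le> a"
    then have "b \<in> S' e" using b(1) sub[of e] a subdivD[OF sd(2) e] by force
    then show False using nxt_le[OF wf sd(2) e, of b a] * b by (auto simp: n_def)
  qed
  obtain s where s: "s \<in> Z" "\<And>t. b \<le> t \<Longrightarrow> t \<le> nxt H S e b \<Longrightarrow> f (pt H e t) = f (pt H e b) + s * (t - b)"
    using f e b(1) unfolding aff_def by (meson atLeastAtMost_iff)
  have "f (pt H e t) = f (pt H e a) + s * (t - a)" if "t \<in> {a..n}" for t
    using s(2)[of t] s(2)[of a] that ba nb n by (auto simp: algebra_simps)
  then show "\<exists>s\<in>Z. \<forall>t\<in>{a..nxt H S' e a}. f (pt H e t) = f (pt H e a) + s * (t - a)"
    using s(1) n_def by blast
qed

lemma subdiv_Un: "subdiv H S \<Longrightarrow> subdiv H S' \<Longrightarrow> subdiv H (\<lambda>e. S e \<union> S' e)"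
  by (auto simp: subdiv_def)

lemma aff_common:
  assumes "wf_mgraph H" "subdiv H S" "subdiv H S'" "aff H S Z f" "aff H S' Z' g"
  shows "subdiv H (\<lambda>e. S e \<union> S' e)" "aff H (\<lambda>e. S e \<union> S' e) Z f" "aff H (\<lambda>e. S e \<union> S' e) Z' g"
  by (rule subdiv_Un[OF assms(2,3)], rule aff_refine[OF assms(1,2) subdiv_Un[OF assms(2,3)] _ assms(4)], simp,
      rule aff_refine[OF assms(1,3) subdiv_Un[OF assms(2,3)] _ assms(5)], simp)

lemma aff_lin:
  assumes "aff H S Z f" "aff H S Z' g"
  shows "aff H S {s + k * s' | s s'. s \<in> Z \<and> s' \<in> Z'} (\<lambda>p. f p + k * g p)"
  unfolding aff_def
proof (intro ballI)
  fix e a assume *: "e \<in> edges H" "a \<in> insert 0 (S e)"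
  obtain s where s: "s \<in> Z" "\<And>t. t \<in> {a..nxt H S e a} \<Longrightarrow> f (pt H e t) = f (pt H e a) + s * (t - a)"
    using assms * unfolding aff_def by metis
  obtain s' where s': "s' \<in> Z'" "\<And>t. t \<in> {a..nxt H S e a} \<Longrightarrow> g (pt H e t) = g (pt H e a) + s' * (t - a)"
    using assms * unfolding aff_def by metis
  show "\<exists>s\<in>{s + k * s' | s s'. s \<in> Z \<and> s' \<in> Z'}. \<forall>t\<in>{a..nxt H S e a}.
     f (pt H e t) + k * g (pt H e t) = f (pt H e a) + k * g (pt H e a) + s * (t - a)"
    proof (intro bexI[of _ "s + k * s'"] ballI)
    fix t assume "t \<in> {a..nxt H S e a}"
    note t = s(2)[OF this] s'(2)[OF this]
    show "f (pt H e t) + k * g (pt H e t) = f (pt H e a) + k * g (pt H e a) + (s + k * s') * (t - a)"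
      unfolding t by (simp add: algebra_simps)
  qed (use s(1) s'(1) in blast)
qed

text \<open>Sets of cut points replace the sequences of breakpoints, because a common refinement of
  two functions is then just a union. Sorting the cut points together with both ends recovers a
  sequence.\<close>

lemma rational_fun_model:
  assumes wf: "wf_mgraph H"
  shows "rational_fun H f \<longleftrightarrow> (\<exists>S. subdiv H S \<and> aff H S \<int> f)"
proof
  assume "rational_fun H f"
  then have "\<forall>e\<in>edges H. \<exists>n x. x 0 = 0 \<and> x n = len H e \<and> (\<forall>i<n. x i < x (Suc i)) \<and>
        (\<forall>i<n. \<exists>s::int. \<forall>t\<in>{x i..x (Suc i)}. f (pt H e t) = f (pt H e (x i)) + of_int s * (t - x i))"
    unfolding rational_fun_def pw_affine_int_def edge_fun_pt .
  then obtain n x where x: "\<And>e. e \<in> edges H \<Longrightarrow> x e 0 = 0" "\<And>e. e \<in> edges H \<Longrightarrow> x e (n e) = len H e"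
    "\<And>e i. e \<in> edges H \<Longrightarrow> i < n e \<Longrightarrow> x e i < x e (Suc i)"
    "\<And>e i. e \<in> edges H \<Longrightarrow> i < n e \<Longrightarrow>
       \<exists>s::int. \<forall>t\<in>{x e i..x e (Suc i)}. f (pt H e t) = f (pt H e (x e i)) + of_int s * (t - x e i)"
    by metis
  have mono: "x e i < x e j" if "e \<in> edges H" "i < j" "j \<le> n e" for e i j
    using that(2,3)
  proof (induction j)
    case (Suc j) then show ?case using x(3)[OF that(1), of j] by (cases "i = j") auto
  qed auto
  define S where "S = (\<lambda>e. x e ` {0<..<n e})"
  have "0 < x e i \<and> x e i < len H e" if "e \<in> edges H" "0 < i" "i < n e" for e i
    using mono[OF that(1), of 0 i] mono[OF that(1), of i "n e"] x(1,2)[OF that(1)] that by auto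
  then have sd: "subdiv H S" unfolding subdiv_def S_def by auto
  have "aff H S \<int> f"
    unfolding aff_def
  proof (intro ballI)
    fix e a assume e: "e \<in> edges H" and a: "a \<in> insert 0 (S e)"
    have n0: "0 < n e" using x(1,2)[OF e] wf_mgraphD(6)[OF wf e] by (cases "n e") auto
    obtain i where i: "i < n e" "a = x e i"
      using a n0 x(1)[OF e] by (force simp: S_def)
    have "x e (Suc i) \<in> insert (len H e) (S e)"
      using i x(2)[OF e] by (cases "Suc i = n e") (auto simp: S_def)
    then have "nxt H S e a \<le> x e (Suc i)" using x(3)[OF e i(1)] i by (intro nxt_le[OF wf sd e]) auto
    moreover obtain s :: int where s: "\<forall>t\<in>{x e i..x e (Suc i)}. f (pt H e t) = f (pt H e (x e i)) + of_int s * (t - x e i)"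
      using x(4)[OF e i(1)] by blast
    ultimately have "\<forall>t\<in>{a..nxt H S e a}. f (pt H e t) = f (pt H e a) + of_int s * (t - a)"
      unfolding i(2) by (meson atLeastAtMost_iff order_trans)
    then show "\<exists>s\<in>\<int>. \<forall>t\<in>{a..nxt H S e a}. f (pt H e t) = f (pt H e a) + s * (t - a)"
      using Ints_of_int by blast
  qed
  then show "\<exists>S. subdiv H S \<and> aff H S \<int> f" using sd by blast
next
  assume "\<exists>S. subdiv H S \<and> aff H S \<int> f"
  then obtain S where sd: "subdiv H S" and f: "aff H S \<int> f" by blast
  show "rational_fun H f"
    unfolding rational_fun_def pw_affine_int_def edge_fun_pt
  proof
    fix e assume e: "e \<in> edges H"
    note s = subdivD[OF sd e]
    define xs where "xs = sorted_list_of_set (insert 0 (insert (len H e) (S e)))"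
    have fin: "finite (insert 0 (insert (len H e) (S e)))" using s by auto
    have set: "set xs = insert 0 (insert (len H e) (S e))"
      unfolding xs_def by (rule set_sorted_list_of_set[OF fin])
    have srt: "sorted xs" "distinct xs" unfolding xs_def by (rule sorted_sorted_list_of_set distinct_sorted_list_of_set)+
    have lp: "0 < len H e" by (rule wf_mgraphD(6)[OF wf e])
    define n where "n = length xs - 1"
    have "card (set xs) \<ge> card {0, len H e}" unfolding set using s by (intro card_mono) auto
    then have len: "length xs = Suc n" "0 < n" using lp srt distinct_card[of xs] by (auto simp: n_def)
    have lt: "xs ! i < xs ! j" if "i < j" "j \<le> n" for i j
      using that srt len sorted_wrt_nth_less[of "(<)" xs i j] by (auto simp: strict_sorted_iff)
    have bnd: "0 \<le> xs ! i" "xs ! i \<le> len H e" if "i \<le> n" for i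
      using nth_mem[of i xs] that len set s lp by (auto simp: less_imp_le)
    have "xs ! 0 = 0"
    proof -
      obtain i where "i \<le> n" "xs ! i = 0" using set len by (metis in_set_conv_nth insertI1 less_Suc_eq_le)
      then show ?thesis using lt[of 0 i] bnd[of 0] by (cases "i = 0") auto
    qed
    moreover have "xs ! n = len H e"
    proof -
      obtain i where "i \<le> n" "xs ! i = len H e" using set len by (metis in_set_conv_nth insertI1 insertI2 less_Suc_eq_le)
      then show ?thesis using lt[of i n] bnd[of n] by (cases "i = n") auto
    qed
    moreover have "\<exists>s::int. \<forall>t\<in>{xs ! i..xs ! Suc i}. f (pt H e t) = f (pt H e (xs ! i)) + of_int s * (t - xs ! i)"
      if i: "i < n" for i
    proof -
      have il: "xs ! i < len H e" using lt[of i n] \<open>xs ! n = len H e\<close> i by auto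
      then have a: "xs ! i \<in> insert 0 (S e)" using nth_mem[of i xs] set i len by auto
      have "nxt H S e (xs ! i) \<in> set xs" using nxt_in[OF wf sd e, of "xs ! i"] set by auto
      then obtain j where j: "j \<le> n" "nxt H S e (xs ! i) = xs ! j" using len by (metis in_set_conv_nth less_Suc_eq_le)
      have "i < j" using nxt_gt'[OF wf sd e a] j lt[of j i] i by (cases i j rule: linorder_cases) auto
      then have "xs ! Suc i \<le> nxt H S e (xs ! i)" using j lt[of "Suc i" j] by (cases "Suc i = j") auto
      moreover obtain s where "s \<in> \<int>" "\<forall>t\<in>{xs ! i..nxt H S e (xs ! i)}. f (pt H e t) = f (pt H e (xs ! i)) + s * (t - xs ! i)"
        using f e a unfolding aff_def by blast
      ultimately have "\<exists>s\<in>\<int>. \<forall>t\<in>{xs ! i..xs ! Suc i}. f (pt H e t) = f (pt H e (xs ! i)) + s * (t - xs ! i)"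
        by (meson atLeastAtMost_iff order_trans)
      then show ?thesis by (metis Ints_cases)
    qed
    ultimately show "\<exists>(n::nat) (x::nat \<Rightarrow> real). x 0 = 0 \<and> x n = len H e \<and> (\<forall>i<n. x i < x (Suc i)) \<and>
        (\<forall>i<n. \<exists>s::int. \<forall>t\<in>{x i..x (Suc i)}. f (pt H e t) = f (pt H e (x i)) + of_int s * (t - x i))"
      using lt by (intro exI[of _ n] exI[of _ "\<lambda>i. xs ! i"] conjI allI impI) simp_all
  qed
qed

text \<open>Piecewise linear interpolation of node values. As \<open>prv\<close> is strict, an
  interior node is evaluated as the right end of the segment before it.\<close>

definition ext :: "('v, 'e) mgraph \<Rightarrow> ('e \<Rightarrow> real set) \<Rightarrow> (('v, 'e) point \<Rightarrow> real) \<Rightarrow> ('v, 'e) point \<Rightarrow> real" where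
  "ext H S F p = (case p of Vtx v \<Rightarrow> F p
     | Inner e t \<Rightarrow> F (pt H e (prv S e t)) + dslope (model H S) F (e, prv S e t) * (t - prv S e t))"

lemma ext_pt:
  assumes wf: "wf_mgraph H" and sd: "subdiv H S" and e: "e \<in> edges H" and a: "a \<in> insert 0 (S e)"
    and t: "a \<le> t" "t \<le> nxt H S e a"
  shows "ext H S F (pt H e t) = F (pt H e a) + dslope (model H S) F (e, a) * (t - a)"
proof -
  note s = subdivD[OF sd e] and lp = wf_mgraphD(6)[OF wf e]
  have nx: "F (pt H e b) + dslope (model H S) F (e, b) * (nxt H S e b - b) = F (pt H e (nxt H S e b))"
    if "b \<in> insert 0 (S e)" for b
    using nxt_gt'[OF wf sd e that] by (simp add: dslope_def model_simps)
  consider "t = 0" | "t = len H e" | "0 < t" "t < len H e" "a < t" | "0 < t" "t < len H e" "a = t"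
    using t a s(2) nxt_le_len[OF wf sd e, of a] by force
  then show ?thesis
  proof cases
    case 1
    then have "a = 0" using t(1) a s(2) by force
    then show ?thesis using 1 by (simp add: ext_def pt_def)
  next
    case 2
    then have "nxt H S e a = len H e" using t nxt_le_len[OF wf sd e, of a] by auto
    then show ?thesis using nx[OF a] 2 lp by (simp add: ext_def pt_def)
  next
    case 3
    then have "prv S e t = a" using prv_eqI[OF wf sd e a] t by auto
    then show ?thesis using 3 by (simp add: ext_def pt_def)
  next
    \<comment> \<open>Here \<open>t\<close> is a cut point: the definition uses the preceding
      segment, whereas the claim uses the one starting at \<open>t\<close>. Both give the node
      value.\<close>
    case 4
    then have "t \<in> S e" using a by auto
    then have "nxt H S e (prv S e t) = t" using nxt_prv[OF wf sd e] by auto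
    then show ?thesis using nx[OF prv_in'[OF wf sd e], of t] 4 by (simp add: ext_def pt_def)
  qed
qed

lemma ext_node:
  assumes wf: "wf_mgraph H" and sd: "subdiv H S" and p: "p \<in> verts (model H S)"
  shows "ext H S F p = F p"
proof (cases p)
  case (Vtx v) then show ?thesis by (simp add: ext_def)
next
  case (Inner e t)
  then have e: "e \<in> edges H" "t \<in> S e" using p by (auto simp: model_simps)
  then have "pt H e t = p" using Inner subdivD(2,3)[OF sd e(1,2)] by (auto simp: pt_def)
  then show ?thesis using ext_pt[OF wf sd e(1), of t t F] e nxt_gt'[OF wf sd e(1), of t] by auto
qed

lemma dslope_ext:
  assumes wf: "wf_mgraph H" and sd: "subdiv H S" and s: "s \<in> edges (model H S)"
  shows "dslope (model H S) (ext H S F) s = dslope (model H S) F s"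
  using wf_mgraphD(4,5)[OF wf_model[OF wf sd] s] ext_node[OF wf sd] by (simp add: dslope_def)

lemma aff_ext:
  assumes wf: "wf_mgraph H" and sd: "subdiv H S"
    and "\<And>s. s \<in> edges (model H S) \<Longrightarrow> dslope (model H S) F s \<in> Z"
  shows "aff H S Z (ext H S F)"
  unfolding aff_def
proof (intro ballI)
  fix e a assume *: "e \<in> edges H" "a \<in> insert 0 (S e)"
  have "ext H S F (pt H e a) = F (pt H e a)" using ext_pt[OF wf sd *, of a] nxt_gt'[OF wf sd *] by auto
  then show "\<exists>s\<in>Z. \<forall>t\<in>{a..nxt H S e a}. ext H S F (pt H e t) = ext H S F (pt H e a) + s * (t - a)"
    using ext_pt[OF wf sd *] assms(3)[of "(e, a)"] * by (intro bexI[of _ "dslope (model H S) F (e, a)"]) (auto simp: model_simps)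
qed

section \<open>Divisors of rational functions and moderators\<close>

lemma rslope_eq:
  assumes "t < b" "\<And>u. t \<le> u \<Longrightarrow> u \<le> b \<Longrightarrow> \<phi> u = \<phi> t + s * (u - t)"
  shows "rslope \<phi> t = s"
proof -
  have "(\<phi> u - \<phi> t) / (u - t) = s" if "t < u" "u < b" for u
    using assms(2)[OF less_imp_le[OF that(1)] less_imp_le[OF that(2)]] that by (simp add: field_simps)
  then have "eventually (\<lambda>u. (\<phi> u - \<phi> t) / (u - t) = s) (at_right t)"
    unfolding eventually_at_right[OF assms(1)] using assms(1) by blast
  then have *: "((\<lambda>u. (\<phi> u - \<phi> t) / (u - t)) \<longlongrightarrow> s) (at_right t)" by (rule tendsto_eventually)
  show ?thesis unfolding rslope_def has_field_derivative_iff
    using * tendsto_unique[OF trivial_limit_at_right_real _ *] by (intro the_equality)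
qed

lemma lslope_eq:
  assumes "a < t" "\<And>u. a \<le> u \<Longrightarrow> u \<le> t \<Longrightarrow> \<phi> u = \<phi> a + s * (u - a)"
  shows "lslope \<phi> t = s"
proof -
  have "(\<phi> u - \<phi> t) / (u - t) = s" if "a < u" "u < t" for u
  proof -
    have "\<phi> u - \<phi> t = s * (u - t)"
      unfolding assms(2)[OF less_imp_le[OF that(1)] less_imp_le[OF that(2)]] assms(2)[OF less_imp_le[OF assms(1)] order_refl]
      by (simp add: algebra_simps)
    then show ?thesis using that by simp
  qed
  then have "eventually (\<lambda>u. (\<phi> u - \<phi> t) / (u - t) = s) (at_left t)"
    unfolding eventually_at_left[OF assms(1)] using assms(1) by blast
  then have *: "((\<lambda>u. (\<phi> u - \<phi> t) / (u - t)) \<longlongrightarrow> s) (at_left t)" by (rule tendsto_eventually)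
  show ?thesis unfolding lslope_def has_field_derivative_iff
    using * tendsto_unique[OF trivial_limit_at_left_real _ *] by (intro the_equality)
qed

text \<open>\<open>ord\<close> is the case \<open>c s = s\<close>; other choices of \<open>c\<close> count the directions in which \<open>f\<close> decreases.\<close>
definition slope_sum :: "('v, 'e) mgraph \<Rightarrow> (real \<Rightarrow> 'a::comm_monoid_add) \<Rightarrow> (('v, 'e) point \<Rightarrow> real) \<Rightarrow> ('v, 'e) point \<Rightarrow> 'a" where
  "slope_sum H c f p = (case p of
      Inner e t \<Rightarrow> c (rslope (edge_fun H f e) t) + c (- lslope (edge_fun H f e) t)
    | Vtx v \<Rightarrow> (\<Sum>e\<in>{e\<in>edges H. src H e = v}. c (rslope (edge_fun H f e) 0))
              + (\<Sum>e\<in>{e\<in>edges H. tgt H e = v}. c (- lslope (edge_fun H f e) (len H e))))"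

lemma ord_slope_sum: "ord H f p = slope_sum H (\<lambda>s. s) f p"
  by (simp add: ord_def slope_sum_def sum_negf split: point.split)

context
  fixes H :: "('v, 'e) mgraph" and S Z f
  assumes wf: "wf_mgraph H" and sd: "subdiv H S" and f: "aff H S Z f"
begin

lemma rslope_aff:
  assumes e: "e \<in> edges H" and a: "a \<in> insert 0 (S e)" and t: "a \<le> t" "t < nxt H S e a"
  shows "rslope (edge_fun H f e) t = dslope (model H S) f (e, a)"
proof (rule rslope_eq[OF t(2)])
  note d = aff_dslope(2)[OF wf sd f e a]
  fix u assume u: "t \<le> u" "u \<le> nxt H S e a"
  show "edge_fun H f e u = edge_fun H f e t + dslope (model H S) f (e, a) * (u - t)"
    unfolding edge_fun_pt d[OF order_trans[OF t(1) u(1)] u(2)] d[OF t(1) less_imp_le[OF t(2)]]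
    by (simp add: algebra_simps)
qed

lemma lslope_aff:
  assumes e: "e \<in> edges H" and a: "a \<in> insert 0 (S e)" and t: "a < t" "t \<le> nxt H S e a"
  shows "lslope (edge_fun H f e) t = dslope (model H S) f (e, a)"
  unfolding edge_fun_pt by (rule lslope_eq[OF t(1)], rule aff_dslope(2)[OF wf sd f e a]) (use t in auto)

text \<open>Directions at a node correspond to incident segments. At a vertex the outgoing ones are
  the \<open>(e, 0)\<close> and the incoming ones the last segments
  \<open>(e, prv S e (len H e))\<close>; an interior node has one of each.\<close>

lemma slope_sum_node:
  assumes p: "p \<in> verts (model H S)"
  shows "slope_sum H c f p = dsum (model H S) c f p"
proof (cases p)
  case (Vtx v)
  let ?M = "model H S"
  have s1: "{s\<in>edges ?M. src ?M s = p} = (\<lambda>e. (e, 0)) ` {e\<in>edges H. src H e = v}"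
  proof -
    have "pt H e a = Vtx v \<longleftrightarrow> a = 0 \<and> src H e = v" if "e \<in> edges H" "a \<in> insert 0 (S e)" for e a
      using subdivD(2,3)[OF sd that(1), of a] that(2) by (auto simp: pt_def)
    then show ?thesis using Vtx by (auto simp: model_simps)
  qed
  have s2: "{s\<in>edges ?M. tgt ?M s = p} = (\<lambda>e. (e, prv S e (len H e))) ` {e\<in>edges H. tgt H e = v}"
  proof -
    have *: "pt H e (nxt H S e a) = Vtx v \<longleftrightarrow> a = prv S e (len H e) \<and> tgt H e = v"
      if e: "e \<in> edges H" and a: "a \<in> insert 0 (S e)" for e a
    proof -
      have "pt H e (nxt H S e a) = Vtx v \<longleftrightarrow> nxt H S e a = len H e \<and> tgt H e = v"
        using nxt_pos[OF wf sd e a] nxt_le_len[OF wf sd e, of a] by (auto simp: pt_def)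
      also have "nxt H S e a = len H e \<longleftrightarrow> a = prv S e (len H e)"
        using prv_nxt[OF wf sd e a] nxt_prv[OF wf sd e, of "len H e"] by auto
      finally show ?thesis .
    qed
    show ?thesis using Vtx * prv_in'[OF wf sd] by (auto simp: model_simps)
  qed
  have "(\<Sum>e\<in>{e\<in>edges H. src H e = v}. c (rslope (edge_fun H f e) 0)) = (\<Sum>s\<in>{s\<in>edges ?M. src ?M s = p}. c (dslope ?M f s))"
  proof -
    have "rslope (edge_fun H f e) 0 = dslope ?M f (e, 0)" if e: "e \<in> edges H" for e
      using nxt_gt'[OF wf sd e, of 0] by (intro rslope_aff[OF e]) auto
    then show ?thesis unfolding s1 by (subst sum.reindex) (auto intro!: inj_onI)
  qed
  moreover have "(\<Sum>e\<in>{e\<in>edges H. tgt H e = v}. c (- lslope (edge_fun H f e) (len H e))) = (\<Sum>s\<in>{s\<in>edges ?M. tgt ?M s = p}. c (- dslope ?M f s))"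
  proof -
    have "lslope (edge_fun H f e) (len H e) = dslope ?M f (e, prv S e (len H e))" if e: "e \<in> edges H" for e
      using prv_lt[OF wf sd e wf_mgraphD(6)[OF wf e]] nxt_prv[OF wf sd e, of "len H e"] prv_in'[OF wf sd e]
      by (intro lslope_aff[OF e]) auto
    then show ?thesis unfolding s2 by (subst sum.reindex) (auto intro!: inj_onI)
  qed
  ultimately show ?thesis using Vtx by (simp add: slope_sum_def dsum_def)
next
  case (Inner e t)
  let ?M = "model H S"
  have e: "e \<in> edges H" and t: "t \<in> S e" using p Inner by (auto simp: model_simps)
  note b = subdivD(2,3)[OF sd e t]
  have "{s\<in>edges ?M. src ?M s = p} = {(e, t)}"
    using Inner e t b by (auto simp: model_simps pt_def split: if_splits)
  moreover have "{s\<in>edges ?M. tgt ?M s = p} = {(e, prv S e t)}"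
  proof -
    have *: "pt H e' (nxt H S e' a) = p \<longleftrightarrow> e' = e \<and> a = prv S e t" if e': "e' \<in> edges H" and a: "a \<in> insert 0 (S e')" for e' a
    proof -
      have "pt H e' (nxt H S e' a) = p \<longleftrightarrow> e' = e \<and> nxt H S e a = t"
        using Inner b by (auto simp: pt_def)
      also have "\<dots> \<longleftrightarrow> e' = e \<and> a = prv S e t"
        using prv_nxt[OF wf sd e, of a] nxt_prv[OF wf sd e, of t] t a by (metis insertCI)
      finally show ?thesis .
    qed
    show ?thesis
    proof (rule set_eqI)
      fix s :: "'e \<times> real"
      obtain e' a where s: "s = (e', a)" by force
      show "s \<in> {s\<in>edges ?M. tgt ?M s = p} \<longleftrightarrow> s \<in> {(e, prv S e t)}"
        using *[of e' a] prv_in'[OF wf sd e, of t] e unfolding s by (auto simp: model_simps)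
    qed
  qed
  moreover have "rslope (edge_fun H f e) t = dslope ?M f (e, t)"
    using t by (intro rslope_aff[OF e] nxt_gt'[OF wf sd e]) auto
  moreover have "lslope (edge_fun H f e) t = dslope ?M f (e, prv S e t)"
    using prv_lt[OF wf sd e b(1)] nxt_prv[OF wf sd e, of t] prv_in'[OF wf sd e] t by (intro lslope_aff[OF e]) auto
  ultimately show ?thesis using Inner by (simp add: slope_sum_def dsum_def)
qed

text \<open>Inside a segment the two directions have opposite slopes. So \<open>ord\<close> is zero
  there, and for a nonzero slope exactly one direction descends, which makes the moderator zero as
  well.\<close>

lemma slope_sum_nonnode:
  assumes p: "p \<in> points H" "p \<notin> verts (model H S)"
  obtains s where "s \<in> edges (model H S)"
    "slope_sum H c f p = c (dslope (model H S) f s) + c (- dslope (model H S) f s)"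
proof -
  obtain e t where Inner: "p = Inner e t" and e: "e \<in> edges H" and t: "0 < t" "t < len H e" "t \<notin> S e"
    using p by (auto simp: points_def model_simps)
  define a where "a = prv S e t"
  have a: "a \<in> insert 0 (S e)" "a < t" "t \<le> nxt H S e a"
    using prv_in'[OF wf sd e] prv_lt[OF wf sd e] le_nxt_prv[OF wf sd e] t unfolding a_def by auto
  then have "t < nxt H S e a" using nxt_in[OF wf sd e, of a] t by (cases "t = nxt H S e a") auto
  then have "slope_sum H c f p = c (dslope (model H S) f (e, a)) + c (- dslope (model H S) f (e, a))"
    unfolding Inner slope_sum_def point.case
    using rslope_aff[OF e a(1) less_imp_le[OF a(2)]] lslope_aff[OF e a(1,2,3)] by simp
  moreover have "(e, a) \<in> edges (model H S)" using e a(1) by (simp add: model_simps)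
  ultimately show ?thesis using that by blast
qed

end

section \<open>Degrees and the divisors of rational functions\<close>

lemma deg_superset: "finite A \<Longrightarrow> supp D \<subseteq> A \<Longrightarrow> deg D = (\<Sum>p\<in>A. D p)"
  unfolding deg_def by (intro sum.mono_neutral_left) (auto simp: supp_def)

lemma deg_lin:
  assumes "is_divisor H D" "is_divisor H E"
  shows "is_divisor H (\<lambda>p. D p + k * E p)" "deg (\<lambda>p. D p + k * E p) = deg D + k * deg E"
proof -
  have s: "supp (\<lambda>p. D p + k * E p) \<subseteq> supp D \<union> supp E" by (auto simp: supp_def)
  then show "is_divisor H (\<lambda>p. D p + k * E p)"
    using assms unfolding is_divisor_def by (meson finite_UnI finite_subset le_sup_iff order_trans)
  have fin: "finite (supp D \<union> supp E)" using assms by (auto simp: is_divisor_def)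
  show "deg (\<lambda>p. D p + k * E p) = deg D + k * deg E"
    using deg_superset[OF fin s] deg_superset[OF fin, of D] deg_superset[OF fin, of E]
    by (simp add: sum.distrib sum_distrib_left)
qed

text \<open>For a rational function \<open>ord\<close> is an integer stored as a real, so the floor
  only changes the type; the value off the curve is set to zero as \<open>is_divisor\<close>
  demands.\<close>

definition dv :: "('v, 'e) mgraph \<Rightarrow> (('v, 'e) point \<Rightarrow> real) \<Rightarrow> ('v, 'e) divisor" where
  "dv H f p = (if p \<in> points H then \<lfloor>ord H f p\<rfloor> else 0)"

lemma dv_model:
  assumes "wf_mgraph H" "subdiv H S" "aff H S \<int> f"
  shows "p \<in> verts (model H S) \<Longrightarrow> real_of_int (dv H f p) = dsum (model H S) (\<lambda>s. s) f p"
    "p \<notin> verts (model H S) \<Longrightarrow> dv H f p = 0"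
    "p \<in> points H \<Longrightarrow> real_of_int (dv H f p) = ord H f p"
proof -
  show 1: "real_of_int (dv H f p) = dsum (model H S) (\<lambda>s. s) f p" if "p \<in> verts (model H S)"
  proof -
    have "dsum (model H S) (\<lambda>s. s) f p \<in> \<int>"
      unfolding dsum_def using aff_dslope(1)[OF assms] by (intro Ints_add Ints_sum) (auto simp: model_simps)
    then show ?thesis using that verts_model_subset[OF assms(2)] slope_sum_node[OF assms that, of "\<lambda>s. s"]
      by (auto simp: dv_def ord_slope_sum)
  qed
  have 0: "ord H f p = 0" if "p \<notin> verts (model H S)" "p \<in> points H"
    using slope_sum_nonnode[OF assms that(2,1), of "\<lambda>s. s"] by (auto simp: ord_slope_sum)
  then show 2: "dv H f p = 0" if "p \<notin> verts (model H S)" using that by (auto simp: dv_def)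
  show "real_of_int (dv H f p) = ord H f p" if "p \<in> points H"
    using that 0 1 2 slope_sum_node[OF assms, of p "\<lambda>s. s"] by (cases "p \<in> verts (model H S)") (auto simp: ord_slope_sum)
qed

lemma dv_divisor:
  assumes wf: "wf_mgraph H" and f: "rational_fun H f"
  shows "is_divisor H (dv H f)" "deg (dv H f) = 0"
proof -
  obtain S where S: "subdiv H S" "aff H S \<int> f" using rational_fun_model[OF wf] f by blast
  let ?M = "model H S"
  have wM: "wf_mgraph ?M" by (rule wf_model[OF wf S(1)])
  have s: "supp (dv H f) \<subseteq> verts ?M" using dv_model(2)[OF wf S] by (auto simp: supp_def)
  then show "is_divisor H (dv H f)" unfolding is_divisor_def
    using verts_model_subset[OF S(1)] finite_subset wf_mgraphD(1)[OF wM] by blast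
  have "real_of_int (deg (dv H f)) = (\<Sum>p\<in>verts ?M. dsum ?M (\<lambda>s. s) f p)"
    using deg_superset[OF wf_mgraphD(1)[OF wM] s] dv_model(1)[OF wf S] by simp
  also have "\<dots> = 0" unfolding sum_dsum[OF wM] by simp
  finally show "deg (dv H f) = 0" by simp
qed

lemma rational_lin:
  assumes wf: "wf_mgraph H" and f: "rational_fun H f" and g: "rational_fun H g"
  shows "rational_fun H (\<lambda>p. f p + of_int k * g p)"
    "dv H (\<lambda>p. f p + of_int k * g p) = (\<lambda>p. dv H f p + k * dv H g p)"
proof -
  obtain S1 where S1: "subdiv H S1" "aff H S1 \<int> f" using rational_fun_model[OF wf] f by blast
  obtain S2 where S2: "subdiv H S2" "aff H S2 \<int> g" using rational_fun_model[OF wf] g by blast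
  define S where "S = (\<lambda>e. S1 e \<union> S2 e)"
  have S: "subdiv H S" "aff H S \<int> f" "aff H S \<int> g"
    unfolding S_def by (rule aff_common[OF wf S1(1) S2(1) S1(2) S2(2)])+
  have l: "aff H S \<int> (\<lambda>p. f p + of_int k * g p)"
    by (rule aff_mono[OF aff_lin[OF S(2,3)]]) auto
  then show "rational_fun H (\<lambda>p. f p + of_int k * g p)" using rational_fun_model[OF wf] S by blast
  show "dv H (\<lambda>p. f p + of_int k * g p) = (\<lambda>p. dv H f p + k * dv H g p)"
  proof
    fix p
    show "dv H (\<lambda>p. f p + of_int k * g p) p = dv H f p + k * dv H g p"
    proof (cases "p \<in> verts (model H S)")
      case True
      have "real_of_int (dv H (\<lambda>p. f p + of_int k * g p) p) = real_of_int (dv H f p + k * dv H g p)"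
        using dv_model(1)[OF wf S(1) l True] dv_model(1)[OF wf S(1,2) True] dv_model(1)[OF wf S(1,3) True]
        by (simp add: dsum_id_add_scale)
      then show ?thesis by (simp only: of_int_eq_iff)
    next
      case False
      then show ?thesis
        using dv_model(2)[OF wf S(1) l] dv_model(2)[OF wf S(1,2)] dv_model(2)[OF wf S(1,3)] by simp
    qed
  qed
qed

lemma RR_dv:
  assumes wf: "wf_mgraph H"
  shows "f \<in> RR H D \<longleftrightarrow> rational_fun H f \<and> (\<forall>p\<in>points H. 0 \<le> dv H f p + D p)"
proof -
  have *: "0 \<le> ord H f p + of_int (D p) \<longleftrightarrow> 0 \<le> dv H f p + D p" if rf: "rational_fun H f" and p: "p \<in> points H" for p
  proof -
    obtain S where S: "subdiv H S" "aff H S \<int> f"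
      using rational_fun_model[OF wf, THEN iffD1, OF rf] by blast
    show ?thesis unfolding dv_model(3)[OF wf S p, symmetric] of_int_add[symmetric] of_int_0_le_iff ..
  qed
  show ?thesis unfolding RR_def mem_Collect_eq
    by (rule conj_cong[OF refl], rule ball_cong[OF refl], rule *)
qed

section \<open>Moderators\<close>

definition neg :: "real \<Rightarrow> int" where "neg s = (if s < 0 then 1 else 0)"

definition moderator :: "('v, 'e) mgraph \<Rightarrow> (('v, 'e) point \<Rightarrow> real) \<Rightarrow> ('v, 'e) divisor" where
  "moderator H h p = (if p \<in> points H then slope_sum H neg h p - 1 else 0)"

text \<open>The slopes may be any nonzero reals: \<open>h\<close> need not be rational, since only
  the signs of its slopes enter the moderator.\<close>

definition nowhere_flat :: "('v, 'e) mgraph \<Rightarrow> (('v, 'e) point \<Rightarrow> real) \<Rightarrow> bool" where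
  "nowhere_flat H h \<longleftrightarrow> (\<exists>S. subdiv H S \<and> aff H S (-{0}) h)"

lemma moderator_model:
  assumes "wf_mgraph H" "subdiv H S" "aff H S (-{0}) h"
  shows "p \<in> verts (model H S) \<Longrightarrow> moderator H h p = dsum (model H S) neg h p - 1"
    "p \<notin> verts (model H S) \<Longrightarrow> moderator H h p = 0"
proof -
  show "moderator H h p = dsum (model H S) neg h p - 1" if "p \<in> verts (model H S)"
    using that verts_model_subset[OF assms(2)] slope_sum_node[OF assms that]
    by (auto simp: moderator_def)
  have "slope_sum H neg h p = 1" if p: "p \<notin> verts (model H S)" "p \<in> points H"
  proof -
    obtain s where s: "s \<in> edges (model H S)"
      "slope_sum H neg h p = neg (dslope (model H S) h s) + neg (- dslope (model H S) h s)"
      using slope_sum_nonnode[OF assms p(2,1)] by blast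
    have "dslope (model H S) h s \<noteq> 0" using aff_dslope(1)[OF assms] s(1) by (cases s) (auto simp: model_simps)
    then show ?thesis using s by (auto simp: neg_def)
  qed
  then show "moderator H h p = 0" if "p \<notin> verts (model H S)" using that by (auto simp: moderator_def)
qed

text \<open>Each segment descends in exactly one of its two directions, so the degree is the number
  of segments minus the number of nodes, which subdivision does not change.\<close>

lemma moderator_divisor:
  assumes wf: "wf_mgraph H" and h: "nowhere_flat H h"
  shows "is_divisor H (moderator H h)" "deg (moderator H h) = int (card (edges H)) - int (card (verts H))"
proof -
  obtain S where S: "subdiv H S" "aff H S (-{0}) h" using h unfolding nowhere_flat_def by blast
  let ?M = "model H S"
  have wM: "wf_mgraph ?M" by (rule wf_model[OF wf S(1)])
  have s: "supp (moderator H h) \<subseteq> verts ?M" using moderator_model(2)[OF wf S] by (auto simp: supp_def)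
  then show "is_divisor H (moderator H h)" unfolding is_divisor_def
    using verts_model_subset[OF S(1)] finite_subset wf_mgraphD(1)[OF wM] by blast
  have "deg (moderator H h) = (\<Sum>p\<in>verts ?M. dsum ?M neg h p) - int (card (verts ?M))"
    using deg_superset[OF wf_mgraphD(1)[OF wM] s] moderator_model(1)[OF wf S] by (simp add: sum_subtractf)
  also have "(\<Sum>p\<in>verts ?M. dsum ?M neg h p) = (\<Sum>s\<in>edges ?M. 1)" unfolding sum_dsum[OF wM]
  proof (rule sum.cong[OF refl])
    fix s assume "s \<in> edges ?M"
    then have "dslope ?M h s \<noteq> 0" using aff_dslope(1)[OF wf S] by (cases s) (auto simp: model_simps)
    then show "neg (dslope ?M h s) + neg (- dslope ?M h s) = 1" by (auto simp: neg_def)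
  qed
  finally show "deg (moderator H h) = int (card (edges H)) - int (card (verts H))"
    using card_model[OF wf S(1)] by simp
qed

text \<open>Every direction descends for exactly one of \<open>h\<close> and \<open>- h\<close>, so
  the two moderators add up to the valency minus 2. At interior nodes the valency is 2 and the
  canonical divisor vanishes.\<close>

lemma moderator_uminus:
  assumes wf: "wf_mgraph H" and h: "nowhere_flat H h"
  shows "nowhere_flat H (\<lambda>p. - h p)"
    "moderator H (\<lambda>p. - h p) = (\<lambda>p. canonical H (\<lambda>_. 0) p - moderator H h p)"
proof -
  obtain S where S: "subdiv H S" "aff H S (-{0}) h" using h unfolding nowhere_flat_def by blast
  let ?M = "model H S"
  have z: "aff H S {0} (\<lambda>_. 0)" by (auto simp: aff_def)
  have S': "aff H S (-{0}) (\<lambda>p. - h p)"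
    using aff_mono[OF aff_lin[OF z S(2), of "-1"], of "-{0}"] by auto
  then show "nowhere_flat H (\<lambda>p. - h p)" using S unfolding nowhere_flat_def by blast
  show "moderator H (\<lambda>p. - h p) = (\<lambda>p. canonical H (\<lambda>_. 0) p - moderator H h p)"
  proof
    fix p
    consider "p \<in> verts ?M" | "p \<notin> verts ?M" "p \<in> points H" | "p \<notin> points H" by blast
    then show "moderator H (\<lambda>p. - h p) p = canonical H (\<lambda>_. 0) p - moderator H h p"
    proof cases
      case 1
      have d: "dslope ?M (\<lambda>p. - h p) s = - dslope ?M h s" for s by (simp add: dslope_def minus_divide_left)
      have n: "neg (- dslope ?M h s) = 1 - neg (dslope ?M h s)" if "s \<in> edges ?M" for s
      proof -
        have "dslope ?M h s \<noteq> 0" using that aff_dslope(1)[OF wf S] by (cases s) (auto simp: model_simps)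
        then show ?thesis
          by (auto simp: neg_def)
      qed
      have "dsum ?M neg (\<lambda>p. - h p) p = (\<Sum>s\<in>{s\<in>edges ?M. src ?M s = p}. 1 - neg (dslope ?M h s))
          + (\<Sum>s\<in>{s\<in>edges ?M. tgt ?M s = p}. 1 - neg (- dslope ?M h s))"
        unfolding dsum_def d using n by (intro arg_cong2[of _ _ _ _ "(+)"] sum.cong) auto
      also have "\<dots> = dsum ?M (\<lambda>_. 1) h p - dsum ?M neg h p" by (simp add: dsum_def sum_subtractf)
      also have "dsum ?M (\<lambda>_. 1) h p = slope_sum H (\<lambda>_. 1) h p" by (rule slope_sum_node[OF wf S 1, symmetric])
      also have "\<dots> = canonical H (\<lambda>_. 0) p + 2" using 1
        by (auto simp: slope_sum_def canonical_def val_def model_simps)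
      finally show ?thesis using moderator_model(1)[OF wf S 1] moderator_model(1)[OF wf S(1) S' 1] by simp
    next
      case 2
      then have "canonical H (\<lambda>_. 0) p = 0" by (auto simp: canonical_def model_simps split: point.split)
      then show ?thesis using moderator_model(2)[OF wf S 2(1)] moderator_model(2)[OF wf S(1) S' 2(1)] by simp
    next
      case 3
      then have "canonical H (\<lambda>_. 0) p = 0" by (auto simp: canonical_def points_def split: point.split)
      then show ?thesis using 3 by (simp add: moderator_def)
    qed
  qed
qed

text \<open>Look at a point where \<open>h\<close> is minimal among the maxima of \<open>f\<close>: in each direction of decrease of \<open>h\<close>
  the slope of \<open>f\<close> is at most \<open>-1\<close>.\<close>
lemma RR_moderator_empty:
  assumes wf: "wf_mgraph H" and h: "nowhere_flat H h"
  shows "RR H (moderator H h) = {}"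
proof (rule ccontr)
  assume "RR H (moderator H h) \<noteq> {}"
  then obtain f where f: "rational_fun H f" "\<And>p. p \<in> points H \<Longrightarrow> 0 \<le> dv H f p + moderator H h p"
    using RR_dv[OF wf] by blast
  obtain S1 where S1: "subdiv H S1" "aff H S1 \<int> f" using rational_fun_model[OF wf] f by blast
  obtain S2 where S2: "subdiv H S2" "aff H S2 (-{0}) h" using h unfolding nowhere_flat_def by blast
  define S where "S = (\<lambda>e. S1 e \<union> S2 e)"
  have S: "subdiv H S" "aff H S \<int> f" "aff H S (-{0}) h"
    unfolding S_def by (rule aff_common[OF wf S1(1) S2(1) S1(2) S2(2)])+
  let ?M = "model H S"
  note w = wf_mgraphD[OF wf_model[OF wf S(1)]]
  define m where "m = Max (f ` verts ?M)"
  have m: "f q \<le> m" if "q \<in> verts ?M" for q using w(1) that by (simp add: m_def)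
  define A where "A = {q\<in>verts ?M. f q = m}"
  have "m \<in> f ` verts ?M" using w unfolding m_def by (intro Max_in) auto
  then have A: "A \<noteq> {}" "finite A" using w by (auto simp: A_def)
  define k where "k = Min (h ` A)"
  have k: "k \<le> h q" if "q \<in> A" for q using A that by (simp add: k_def)
  have "k \<in> h ` A" using A unfolding k_def by (intro Min_in) auto
  then obtain p where p: "p \<in> A" "h p = k" by blast
  have pv: "p \<in> verts ?M" "f p = m" using p by (auto simp: A_def)
  have lt: "f q < f p" if "q \<in> verts ?M" "h q < h p" for q
    using that k[of q] m[of q] p(2) pv by (force simp: A_def)
  have int: "dslope ?M f s \<in> \<int>" if "s \<in> edges ?M" for s
    using that aff_dslope(1)[OF wf S(1,2)] by (cases s) (auto simp: model_simps)
  have le1: "x \<le> - 1" if "x \<in> \<int>" "x < 0" for x :: real using that by (auto elim!: Ints_cases)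
  \<comment> \<open>Compared direction by direction, this gives
    \<open>dv H f p \<le> - (moderator H h p + 1)\<close>, so \<open>f\<close> misses effectivity at
    \<open>p\<close> by at least one.\<close>
  have "dsum ?M (\<lambda>s. s) f p \<le> dsum ?M (\<lambda>s. - real_of_int (neg s)) h p"
  proof (rule dsum_mono)
    fix s assume s: "s \<in> edges ?M"
    note l = w(6)[OF s]
    { assume a: "src ?M s = p"
      have "dslope ?M f s \<le> 0" using m[OF w(5)[OF s]] l a pv by (simp add: dslope_def divide_nonpos_pos)
      moreover have "dslope ?M f s \<le> - 1" if "dslope ?M h s < 0"
      proof (rule le1[OF int[OF s]])
        have "h (tgt ?M s) < h p" using that l a by (simp add: dslope_def divide_less_0_iff)
        from lt[OF w(5)[OF s] this] show "dslope ?M f s < 0" using l a by (simp add: dslope_def divide_neg_pos)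
      qed
      ultimately show "dslope ?M f s \<le> - real_of_int (neg (dslope ?M h s))" by (simp add: neg_def) }
    { assume a: "tgt ?M s = p"
      have "- dslope ?M f s \<le> 0" using m[OF w(4)[OF s]] l a pv by (simp add: dslope_def)
      moreover have "- dslope ?M f s \<le> - 1" if "- dslope ?M h s < 0"
      proof (rule le1)
        show "- dslope ?M f s \<in> \<int>" using int[OF s] by simp
        have "h (src ?M s) < h p" using that l a by (simp add: dslope_def zero_less_divide_iff)
        from lt[OF w(4)[OF s] this] show "- dslope ?M f s < 0" using l a by (simp add: dslope_def)
      qed
      ultimately show "- dslope ?M f s \<le> - real_of_int (neg (- dslope ?M h s))" by (simp add: neg_def) }
  qed
  also have "\<dots> = - real_of_int (dsum ?M neg h p)" by (simp add: dsum_def sum_negf)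
  finally have "dv H f p \<le> - dsum ?M neg h p" using dv_model(1)[OF wf S(1,2) pv(1)] by linarith
  then show False using f(2)[of p] moderator_model(1)[OF wf S(1,3) pv(1)] verts_model_subset[OF S(1)] pv(1) by auto
qed

section \<open>Moderators dominating divisors without sections\<close>

text \<open>One further cut in every segment: the place where the interpolation bends from the floor
  to the ceiling slope.\<close>

definition cutset :: "('e \<Rightarrow> real set) \<Rightarrow> ('e \<Rightarrow> real \<Rightarrow> real) \<Rightarrow> 'e \<Rightarrow> real set" where
  "cutset S brk e = S e \<union> brk e ` insert 0 (S e)"

text \<open>\<open>F\<close> at the old nodes and \<open>w\<close> at the new cuts. The values at
  all other points are arbitrary, as the function is only used through its values at the nodes of
  the refined model.\<close>

definition cutfun :: "('v, 'e) mgraph \<Rightarrow> ('e \<Rightarrow> real set) \<Rightarrow> (('v, 'e) point \<Rightarrow> real) \<Rightarrow> ('e \<Rightarrow> real \<Rightarrow> real)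
    \<Rightarrow> ('v, 'e) point \<Rightarrow> real" where
  "cutfun H S F w p = (if p \<in> verts (model H S) then F p else
     (case p of Inner e t \<Rightarrow> w e (prv S e t) | Vtx v \<Rightarrow> 0))"

context
  fixes H :: "('v, 'e) mgraph" and S brk
  assumes wf: "wf_mgraph H" and sd: "subdiv H S"
    and brk: "\<forall>e\<in>edges H. \<forall>a\<in>insert 0 (S e). a < brk e a \<and> brk e a < nxt H S e a"
begin

lemma cut_bounds:
  assumes e: "e \<in> edges H" and a: "a \<in> insert 0 (S e)"
  shows "a < brk e a" "brk e a < nxt H S e a" "0 < brk e a" "brk e a < len H e" "brk e a \<notin> S e"
    "prv S e (brk e a) = a"
proof -
  show 1: "a < brk e a" "brk e a < nxt H S e a" using brk e a by blast+
  show "0 < brk e a" using 1 subdivD(2)[OF sd e, of a] a by auto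
  show "brk e a < len H e" using 1 nxt_le_len[OF wf sd e, of a] by auto
  show "brk e a \<notin> S e" using 1 nxt_le[OF wf sd e, of "brk e a" a] by auto
  show "prv S e (brk e a) = a" using 1 by (intro prv_eqI[OF wf sd e a]) auto
qed

lemma subdiv_cutset: "subdiv H (cutset S brk)"
  unfolding subdiv_def
proof (intro ballI conjI)
  fix e assume e: "e \<in> edges H"
  show "finite (cutset S brk e)" using subdivD(1)[OF sd e] by (simp add: cutset_def)
  show "cutset S brk e \<subseteq> {0<..<len H e}"
    using subdivD(2,3)[OF sd e] cut_bounds(3,4)[OF e] by (auto simp: cutset_def)
qed

lemma cut_order:
  assumes e: "e \<in> edges H" and a: "a \<in> insert 0 (S e)" and b: "b \<in> insert 0 (S e)" "b < a"
  shows "brk e b < a"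
proof -
  have "a \<in> S e" using a b subdivD(2)[OF sd e, of b] by auto
  then show ?thesis using nxt_le[OF wf sd e, of a b] b cut_bounds(2)[OF e b(1)] by auto
qed

lemma nxt_cutset:
  assumes e: "e \<in> edges H" and a: "a \<in> insert 0 (S e)"
  shows "nxt H (cutset S brk) e a = brk e a" "nxt H (cutset S brk) e (brk e a) = nxt H S e a"
proof -
  note c = cut_bounds[OF e a]
  have S: "nxt H S e a \<le> x" if "x \<in> S e" "a < x" for x using nxt_le[OF wf sd e, of x a] that by auto
  have C: "nxt H S e a < brk e b" if b: "b \<in> insert 0 (S e)" "a < b" for b
  proof -
    have "b \<in> S e" using b a subdivD(2)[OF sd e, of a] by auto
    then show ?thesis using S[OF _ b(2)] cut_bounds(1)[OF e b(1)] by auto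
  qed
  show "nxt H (cutset S brk) e a = brk e a"
  proof (rule nxt_eqI[OF wf subdiv_cutset e])
    show "brk e a \<in> insert (len H e) (cutset S brk e)" using a by (auto simp: cutset_def)
    fix x assume x: "x \<in> cutset S brk e" "a < x"
    show "brk e a \<le> x"
    proof (cases "x \<in> S e")
      case True then show ?thesis using S[of x] x c by auto
    next
      case False
      then obtain b where b: "b \<in> insert 0 (S e)" "x = brk e b" using x by (auto simp: cutset_def)
      then show ?thesis using C[of b] cut_order[OF e a b(1)] x c by (cases a b rule: linorder_cases) auto
    qed
  qed (rule c(1))
  show "nxt H (cutset S brk) e (brk e a) = nxt H S e a"
  proof (rule nxt_eqI[OF wf subdiv_cutset e])
    show "nxt H S e a \<in> insert (len H e) (cutset S brk e)" using nxt_in[OF wf sd e, of a] by (auto simp: cutset_def)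
    fix x assume x: "x \<in> cutset S brk e" "brk e a < x"
    show "nxt H S e a \<le> x"
    proof (cases "x \<in> S e")
      case True then show ?thesis using S[of x] x c by auto
    next
      case False
      then obtain b where b: "b \<in> insert 0 (S e)" "x = brk e b" using x by (auto simp: cutset_def)
      then show ?thesis using C[of b] cut_order[OF e a b(1)] x c by (cases a b rule: linorder_cases) auto
    qed
  qed (rule c(2))
qed

lemma cut_notin_verts:
  "e \<in> edges H \<Longrightarrow> a \<in> insert 0 (S e) \<Longrightarrow> Inner e (brk e a) \<notin> verts (model H S)"
  using cut_bounds(5) by (auto simp: model_simps)

lemma verts_cutset:
  "p \<in> verts (model H (cutset S brk)) \<longleftrightarrow> p \<in> verts (model H S) \<or>
     (\<exists>e\<in>edges H. \<exists>a\<in>insert 0 (S e). p = Inner e (brk e a))"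
  by (auto simp: model_simps cutset_def)

lemma edges_cutset:
  "edges (model H (cutset S brk)) = edges (model H S) \<union> (\<lambda>(e, a). (e, brk e a)) ` edges (model H S)"
  by (auto simp: model_simps cutset_def image_iff)

lemma cutfun_cut:
  assumes e: "e \<in> edges H" and a: "a \<in> insert 0 (S e)"
  shows "cutfun H S F w (pt H e (brk e a)) = w e a"
  using cut_notin_verts[OF assms] cut_bounds(3,4,6)[OF assms] by (simp add: cutfun_def pt_def)

lemma dslope_cutfun:
  assumes e: "e \<in> edges H" and a: "a \<in> insert 0 (S e)"
  shows "dslope (model H (cutset S brk)) (cutfun H S F w) (e, a) = (w e a - F (pt H e a)) / (brk e a - a)"
    "dslope (model H (cutset S brk)) (cutfun H S F w) (e, brk e a)
       = (F (pt H e (nxt H S e a)) - w e a) / (nxt H S e a - brk e a)"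
proof -
  have "cutfun H S F w (pt H e a) = F (pt H e a)"
    using pt_in_verts[OF wf sd e, of a] a by (auto simp: cutfun_def)
  moreover have "cutfun H S F w (pt H e (nxt H S e a)) = F (pt H e (nxt H S e a))"
    using pt_in_verts[OF wf sd e, of "nxt H S e a"] nxt_in[OF wf sd e, of a] by (auto simp: cutfun_def)
  ultimately show "dslope (model H (cutset S brk)) (cutfun H S F w) (e, a) = (w e a - F (pt H e a)) / (brk e a - a)"
    "dslope (model H (cutset S brk)) (cutfun H S F w) (e, brk e a)
       = (F (pt H e (nxt H S e a)) - w e a) / (nxt H S e a - brk e a)"
    using nxt_cutset[OF assms] cutfun_cut[OF assms] by (simp_all add: dslope_def model_simps)
qed

text \<open>The left half of a segment keeps its name \<open>(e, a)\<close> and the right half is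
  called \<open>(e, brk e a)\<close>. Hence the segments starting at \<open>p\<close> are unchanged,
  and those ending at \<open>p\<close> are renamed injectively.\<close>

lemma dsum_cutfun_node:
  assumes p: "p \<in> verts (model H S)"
  shows "dsum (model H (cutset S brk)) c (cutfun H S F w) p =
     (\<Sum>(e, a)\<in>{s\<in>edges (model H S). src (model H S) s = p}. c ((w e a - F (pt H e a)) / (brk e a - a)))
   + (\<Sum>(e, a)\<in>{s\<in>edges (model H S). tgt (model H S) s = p}.
        c (- ((F (pt H e (nxt H S e a)) - w e a) / (nxt H S e a - brk e a))))"
proof -
  let ?M = "model H S" and ?M' = "model H (cutset S brk)"
  have np: "pt H e (brk e a) \<noteq> p" if "e \<in> edges H" "a \<in> insert 0 (S e)" for e a
    using cut_notin_verts[OF that] cut_bounds(3,4)[OF that] p by (auto simp: pt_def)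
  have s1: "{s\<in>edges ?M'. src ?M' s = p} = {s\<in>edges ?M. src ?M s = p}"
  proof (rule set_eqI)
    fix s
    have 1: "src ?M' s = src ?M s" by (cases s) (simp add: model_simps)
    have 2: "src ?M' s \<noteq> p" if im: "s \<in> (\<lambda>(e, a). (e, brk e a)) ` edges ?M"
    proof -
      obtain e a where "(e, a) \<in> edges ?M" "s = (e, brk e a)" using im by auto
      then show ?thesis using np[of e a] by (simp add: model_simps)
    qed
    show "s \<in> {s\<in>edges ?M'. src ?M' s = p} \<longleftrightarrow> s \<in> {s\<in>edges ?M. src ?M s = p}"
      unfolding edges_cutset using 1 2 by (cases "s \<in> edges ?M") simp_all
  qed
  have s2: "{s\<in>edges ?M'. tgt ?M' s = p} = (\<lambda>(e, a). (e, brk e a)) ` {s\<in>edges ?M. tgt ?M s = p}"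
  proof -
    have 1: "tgt ?M' s \<noteq> p" if "s \<in> edges ?M" for s
      using that np[of "fst s" "snd s"] nxt_cutset(1)[of "fst s" "snd s"] by (cases s) (simp add: model_simps)
    have 2: "tgt ?M' (e, brk e a) = tgt ?M (e, a)" if "(e, a) \<in> edges ?M" for e a
      using that nxt_cutset(2)[of e a] by (auto simp: model_simps)
    show ?thesis
    proof (rule set_eqI, rule iffI)
      fix s assume s: "s \<in> {s\<in>edges ?M'. tgt ?M' s = p}"
      then obtain e a where ea: "(e, a) \<in> edges ?M" "s = (e, brk e a)"
        using 1[of s] unfolding edges_cutset by auto
      then have "(e, a) \<in> {s\<in>edges ?M. tgt ?M s = p}" using s 2[of e a] by simp
      then show "s \<in> (\<lambda>(e, a). (e, brk e a)) ` {s\<in>edges ?M. tgt ?M s = p}" unfolding ea(2) by (rule rev_image_eqI) simp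
    next
      fix s assume "s \<in> (\<lambda>(e, a). (e, brk e a)) ` {s\<in>edges ?M. tgt ?M s = p}"
      then obtain e a where ea: "(e, a) \<in> edges ?M" "tgt ?M (e, a) = p" "s = (e, brk e a)" by auto
      then show "s \<in> {s\<in>edges ?M'. tgt ?M' s = p}"
        using 2[OF ea(1)] unfolding edges_cutset by force
    qed
  qed
  have inj: "inj_on (\<lambda>(e, a). (e, brk e a)) {s\<in>edges ?M. tgt ?M s = p}"
  proof (rule inj_onI)
    fix s t assume st: "s \<in> {s\<in>edges ?M. tgt ?M s = p}" "t \<in> {s\<in>edges ?M. tgt ?M s = p}"
      "(\<lambda>(e, a). (e, brk e a)) s = (\<lambda>(e, a). (e, brk e a)) t"
    obtain e a b where *: "s = (e, a)" "t = (e, b)" "brk e a = brk e b" using st(3) by (cases s; cases t) auto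
    then have "e \<in> edges H" "a \<in> insert 0 (S e)" "b \<in> insert 0 (S e)" using st(1,2) by (auto simp: model_simps)
    then have "prv S e (brk e a) = a" "prv S e (brk e b) = b" using cut_bounds(6) by blast+
    then have "a = b" using *(3) by metis
    then show "s = t" using *(1,2) by simp
  qed
  have "(\<Sum>s\<in>{s\<in>edges ?M. src ?M s = p}. c (dslope ?M' (cutfun H S F w) s)) =
      (\<Sum>(e, a)\<in>{s\<in>edges ?M. src ?M s = p}. c ((w e a - F (pt H e a)) / (brk e a - a)))"
  proof (rule sum.cong[OF refl])
    fix s assume s: "s \<in> {s\<in>edges ?M. src ?M s = p}"
    obtain e a where ea: "s = (e, a)" by force
    then have "e \<in> edges H" "a \<in> insert 0 (S e)" using s by (auto simp: model_simps)
    from dslope_cutfun(1)[OF this] show "c (dslope ?M' (cutfun H S F w) s) = (case s of (e, a) \<Rightarrow> c ((w e a - F (pt H e a)) / (brk e a - a)))"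
      unfolding ea by simp
  qed
  moreover have "(\<Sum>s\<in>{s\<in>edges ?M. tgt ?M s = p}. c (- dslope ?M' (cutfun H S F w) ((\<lambda>(e, a). (e, brk e a)) s))) =
      (\<Sum>(e, a)\<in>{s\<in>edges ?M. tgt ?M s = p}. c (- ((F (pt H e (nxt H S e a)) - w e a) / (nxt H S e a - brk e a))))"
  proof (rule sum.cong[OF refl])
    fix s assume s: "s \<in> {s\<in>edges ?M. tgt ?M s = p}"
    obtain e a where ea: "s = (e, a)" by force
    then have "e \<in> edges H" "a \<in> insert 0 (S e)" using s by (auto simp: model_simps)
    from dslope_cutfun(2)[OF this] show "c (- dslope ?M' (cutfun H S F w) ((\<lambda>(e, a). (e, brk e a)) s)) = (case s of (e, a) \<Rightarrow> c (- ((F (pt H e (nxt H S e a)) - w e a) / (nxt H S e a - brk e a))))"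
      unfolding ea by simp
  qed
  ultimately show ?thesis unfolding dsum_def s1 s2 sum.reindex[OF inj] comp_def by simp
qed

lemma dsum_cutfun_cut:
  assumes e: "e \<in> edges H" and a: "a \<in> insert 0 (S e)"
  shows "dsum (model H (cutset S brk)) c (cutfun H S F w) (Inner e (brk e a)) =
     c ((F (pt H e (nxt H S e a)) - w e a) / (nxt H S e a - brk e a))
   + c (- ((w e a - F (pt H e a)) / (brk e a - a)))"
proof -
  let ?M' = "model H (cutset S brk)"
  note b = cut_bounds[OF e a] and sc = subdiv_cutset
  have ca: "brk e a \<in> cutset S brk e" "a \<in> insert 0 (cutset S brk e)" using a by (auto simp: cutset_def)
  have "{s\<in>edges ?M'. src ?M' s = Inner e (brk e a)} = {(e, brk e a)}"
    using e ca(1) b by (auto simp: model_simps pt_def split: if_splits)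
  moreover have "{s\<in>edges ?M'. tgt ?M' s = Inner e (brk e a)} = {(e, a)}"
  proof (rule set_eqI)
    fix s :: "'e \<times> real"
    obtain e' x where s: "s = (e', x)" by force
    show "s \<in> {s\<in>edges ?M'. tgt ?M' s = Inner e (brk e a)} \<longleftrightarrow> s \<in> {(e, a)}"
    proof
      assume "s \<in> {s\<in>edges ?M'. tgt ?M' s = Inner e (brk e a)}"
      then have "e' \<in> edges H" "x \<in> insert 0 (cutset S brk e')" "pt H e' (nxt H (cutset S brk) e' x) = Inner e (brk e a)"
        by (auto simp: s model_simps)
      then have "e' = e" "x \<in> insert 0 (cutset S brk e)" "nxt H (cutset S brk) e x = brk e a"
        by (auto simp: pt_def split: if_splits)
      then show "s \<in> {(e, a)}"
        using prv_nxt[OF wf sc e, of x] prv_nxt[OF wf sc e ca(2)] nxt_cutset(1)[OF e a] s by auto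
    next
      assume "s \<in> {(e, a)}"
      then show "s \<in> {s\<in>edges ?M'. tgt ?M' s = Inner e (brk e a)}"
        using e ca(2) nxt_cutset(1)[OF e a] b by (auto simp: model_simps pt_def)
    qed
  qed
  ultimately show ?thesis unfolding dsum_def using dslope_cutfun[OF e a] by simp
qed

end

section \<open>Interpolation of the extremal function and of the burning order\<close>

lemma dsum_ext:
  assumes "wf_mgraph H" "subdiv H S"
  shows "dsum (model H S) c (ext H S F) p = dsum (model H S) c F p"
  unfolding dsum_def using dslope_ext[OF assms] by simp

text \<open>Solving \<open>\<lfloor>d\<rfloor> * (c - a) + \<lceil>d\<rceil> * (b - c) = y -
  x\<close> for \<open>c\<close> gives \<open>b - c = frac d * (b - a)\<close>. For integral
  \<open>d\<close> there is no bend, and the midpoint is an arbitrary interior choice.\<close>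

lemma floor_interpolation:
  fixes x y a b d :: real
  assumes "a < b" and d: "d = (y - x) / (b - a)"
    and c: "c = (if d \<in> \<int> then (a + b) / 2 else b - frac d * (b - a))" and w: "w = x + of_int \<lfloor>d\<rfloor> * (c - a)"
  shows "a < c \<and> c < b" "(w - x) / (c - a) = \<lfloor>d\<rfloor>" "(y - w) / (b - c) = \<lceil>d\<rceil>"
proof -
  show 1: "a < c \<and> c < b"
  proof (cases "d \<in> \<int>")
    case True then show ?thesis using c assms(1) by simp
  next
    case False
    have "frac d * (b - a) < 1 * (b - a)" using frac_lt_1[of d] assms(1) by (intro mult_strict_right_mono) auto
    moreover have "0 < frac d * (b - a)" using False assms(1) by simp
    ultimately show ?thesis using c False by simp
  qed
  show "(w - x) / (c - a) = \<lfloor>d\<rfloor>" using 1 w by simp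
  have y: "y = x + d * (b - a)" using d assms(1) by simp
  have "y - w = \<lceil>d\<rceil> * (b - c)"
  proof (cases "d \<in> \<int>")
    case True
    then obtain k where "d = of_int k" by (auto elim: Ints_cases)
    then show ?thesis using y w by (simp add: algebra_simps)
  next
    case False
    then have "\<lceil>d\<rceil> = \<lfloor>d\<rfloor> + 1" by (simp add: ceiling_altdef) (metis Ints_of_int)
    moreover have "d = \<lfloor>d\<rfloor> + frac d" by (simp add: frac_def)
    moreover have "b - c = frac d * (b - a)" using c False by simp
    moreover have "c - a = (b - a) - frac d * (b - a)" using c False by simp
    ultimately have "y - w = (\<lfloor>d\<rfloor> + frac d) * (b - a) - \<lfloor>d\<rfloor> * ((b - a) - frac d * (b - a))" "\<lceil>d\<rceil> * (b - c) = (\<lfloor>d\<rfloor> + 1) * (frac d * (b - a))"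
      using y w by simp_all
    then show ?thesis by (simp add: algebra_simps)
  qed
  then show "(y - w) / (b - c) = \<lceil>d\<rceil>" using 1 by simp
qed

text \<open>\<open>f\<close> interpolates the extremal \<open>F\<close>, and \<open>g\<close>
  interpolates the burning times. Where fire passes a segment, \<open>g\<close> is monotone along it
  and its later end sees a descent. On every other segment \<open>g\<close> has a peak at the cut,
  with moderator 1 there, which absorbs the chip that a bend of \<open>f\<close> may create.\<close>

lemma RR_empty_moderator:
  assumes wf: "wf_mgraph H" and D: "is_divisor H D" and R: "RR H D = {}"
  obtains f h where "rational_fun H f" "nowhere_flat H h" "\<And>p. D p + dv H f p \<le> moderator H h p"
proof -
  define S where "S = (\<lambda>e. {t. Inner e t \<in> supp D})"
  have sd: "subdiv H S"
    unfolding subdiv_def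
  proof (intro ballI conjI)
    fix e
    show "finite (S e)" unfolding S_def using D
      by (intro finite_vimageI[of "supp D" "Inner e", unfolded vimage_def]) (auto simp: is_divisor_def inj_on_def)
    show "S e \<subseteq> {0<..<len H e}" unfolding S_def using D by (auto simp: is_divisor_def points_def)
  qed
  define M where "M = model H S"
  have wM: "wf_mgraph M" unfolding M_def by (rule wf_model[OF wf sd])
  note w = wf_mgraphD[OF wM]
  have Dz: "D p = 0" if "p \<notin> verts M" for p
  proof (rule ccontr)
    assume "D p \<noteq> 0"
    then have "p \<in> supp D" "p \<in> points H" using D by (auto simp: supp_def is_divisor_def)
    then show False using that by (auto simp: M_def model_simps points_def S_def)
  qed
  obtain v0 where v0: "v0 \<in> verts M" using w by auto
  obtain F where F: "F \<in> subharm M v0 D"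
    and max: "\<And>F' p. F' \<in> subharm M v0 D \<Longrightarrow> p \<in> verts M \<Longrightarrow> F' p \<le> F p"
    using subharm_greatest[OF wM v0] by blast
  let ?C = "\<lambda>h p. (\<Sum>s\<in>{s\<in>edges M. src M s = p}. if dslope M F s \<in> \<int> \<and> h (tgt M s) < h p then 1 else 0 :: int)
      + (\<Sum>s\<in>{s\<in>edges M. tgt M s = p}. if dslope M F s \<in> \<int> \<and> h (src M s) < h p then 1 else 0)"
  obtain h :: "('a, 'b) point \<Rightarrow> real" where h: "inj_on h (verts M)"
    and burn: "\<And>p. p \<in> verts M - {v0} \<Longrightarrow> dsum M floor F p + D p < ?C h p"
    using burning_order[OF wM v0 F] max by blast
  define d where "d = (\<lambda>e a. dslope M F (e, a))"
  define brk where "brk = (\<lambda>e a. if d e a \<in> \<int> then (a + nxt H S e a) / 2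
     else nxt H S e a - frac (d e a) * (nxt H S e a - a))"
  define wF where "wF = (\<lambda>e a. F (pt H e a) + of_int \<lfloor>d e a\<rfloor> * (brk e a - a))"
  \<comment> \<open>A segment whose ends coincide is excluded: its burning times agree, so the mean
    would make \<open>g\<close> constant on it.\<close>
  define flat where "flat = (\<lambda>e a. d e a \<in> \<int> \<and> pt H e a \<noteq> pt H e (nxt H S e a))"
  \<comment> \<open>The mean makes \<open>g\<close> strictly monotone along the segment, since
    \<open>h\<close> is injective on nodes; the value above both ends makes a peak.\<close>
  define wh where "wh = (\<lambda>e a. if flat e a then (h (pt H e a) + h (pt H e (nxt H S e a))) / 2
     else max (h (pt H e a)) (h (pt H e (nxt H S e a))) + 1)"
  have fl: "a < brk e a \<and> brk e a < nxt H S e a"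
      "(wF e a - F (pt H e a)) / (brk e a - a) = \<lfloor>d e a\<rfloor>"
      "(F (pt H e (nxt H S e a)) - wF e a) / (nxt H S e a - brk e a) = \<lceil>d e a\<rceil>"
    if "e \<in> edges H" "a \<in> insert 0 (S e)" for e a
  proof -
    have d': "d e a = (F (pt H e (nxt H S e a)) - F (pt H e a)) / (nxt H S e a - a)"
      by (simp add: d_def M_def dslope_def model_simps)
    have b: "brk e a = (if d e a \<in> \<int> then (a + nxt H S e a) / 2
        else nxt H S e a - frac (d e a) * (nxt H S e a - a))" by (simp add: brk_def)
    have "wF e a = F (pt H e a) + of_int \<lfloor>d e a\<rfloor> * (brk e a - a)" by (simp add: wF_def)
    note * = floor_interpolation[OF nxt_gt'[OF wf sd that] d' b this]
    show "a < brk e a \<and> brk e a < nxt H S e a"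
      "(wF e a - F (pt H e a)) / (brk e a - a) = \<lfloor>d e a\<rfloor>"
      "(F (pt H e (nxt H S e a)) - wF e a) / (nxt H S e a - brk e a) = \<lceil>d e a\<rceil>"
      by (rule *)+
  qed
  have brk: "\<forall>e\<in>edges H. \<forall>a\<in>insert 0 (S e). a < brk e a \<and> brk e a < nxt H S e a"
    using fl(1) by blast
  define S' where "S' = cutset S brk"
  define M' where "M' = model H S'"
  have sd': "subdiv H S'" unfolding S'_def by (rule subdiv_cutset[OF wf sd brk])
  define f where "f = ext H S' (cutfun H S F wF)"
  define g where "g = ext H S' (cutfun H S h wh)"
  note node = dsum_cutfun_node[OF wf sd brk, folded S'_def, folded M'_def M_def]
  note cutn = dsum_cutfun_cut[OF wf sd brk, folded S'_def, folded M'_def M_def]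
  note dsl = dslope_cutfun[OF wf sd brk, folded S'_def, folded M'_def M_def]
  note vc = verts_cutset[OF wf sd brk, folded S'_def, folded M'_def M_def]
  note ec = edges_cutset[OF wf sd brk, folded S'_def, folded M'_def M_def]
  have E: "(e, a) \<in> edges M \<longleftrightarrow> e \<in> edges H \<and> a \<in> insert 0 (S e)" for e a by (simp add: M_def model_simps)
  have Ec: "\<exists>e\<in>edges H. \<exists>a\<in>insert 0 (S e). s = (e, a) \<or> s = (e, brk e a)" if "s \<in> edges M'" for s
  proof (cases "s \<in> edges M")
    case True
    then show ?thesis using E[of "fst s" "snd s"] by (metis prod.collapse)
  next
    case False
    then obtain e a where "(e, a) \<in> edges M" "s = (e, brk e a)"
      using \<open>s \<in> edges M'\<close> unfolding ec by auto
    then show ?thesis using E by blast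
  qed
  have ne: "h (pt H e a) \<noteq> h (pt H e (nxt H S e a))"
    if ea: "e \<in> edges H" "a \<in> insert 0 (S e)" and fl: "flat e a" for e a
  proof -
    have "(e, a) \<in> edges M" using ea E by blast
    then have v: "pt H e a \<in> verts M" "pt H e (nxt H S e a) \<in> verts M"
      using w(4,5)[of "(e, a)"] by (simp_all add: M_def model_simps)
    show ?thesis using inj_onD[OF h _ v] fl by (auto simp: flat_def)
  qed
  have sg: "(wh e a - h (pt H e a)) / (brk e a - a) < 0 \<longleftrightarrow> flat e a \<and> h (pt H e (nxt H S e a)) < h (pt H e a)"
      "(wh e a - h (pt H e a)) / (brk e a - a) > 0 \<longleftrightarrow> \<not> (flat e a \<and> h (pt H e (nxt H S e a)) < h (pt H e a))"
      "(h (pt H e (nxt H S e a)) - wh e a) / (nxt H S e a - brk e a) > 0 \<longleftrightarrow> flat e a \<and> h (pt H e a) < h (pt H e (nxt H S e a))"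
      "(h (pt H e (nxt H S e a)) - wh e a) / (nxt H S e a - brk e a) < 0 \<longleftrightarrow> \<not> (flat e a \<and> h (pt H e a) < h (pt H e (nxt H S e a)))"
    if ea: "e \<in> edges H" "a \<in> insert 0 (S e)" for e a
  proof -
    show "(wh e a - h (pt H e a)) / (brk e a - a) < 0 \<longleftrightarrow> flat e a \<and> h (pt H e (nxt H S e a)) < h (pt H e a)"
      "(wh e a - h (pt H e a)) / (brk e a - a) > 0 \<longleftrightarrow> \<not> (flat e a \<and> h (pt H e (nxt H S e a)) < h (pt H e a))"
      "(h (pt H e (nxt H S e a)) - wh e a) / (nxt H S e a - brk e a) > 0 \<longleftrightarrow> flat e a \<and> h (pt H e a) < h (pt H e (nxt H S e a))"
      "(h (pt H e (nxt H S e a)) - wh e a) / (nxt H S e a - brk e a) < 0 \<longleftrightarrow> \<not> (flat e a \<and> h (pt H e a) < h (pt H e (nxt H S e a)))"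
      using fl(1)[OF ea] ne[OF ea] by (auto simp: wh_def divide_less_0_iff zero_less_divide_iff)
  qed
  have fint: "aff H S' \<int> f" unfolding f_def
  proof (rule aff_ext[OF wf sd'], fold M'_def)
    fix s assume "s \<in> edges M'"
    then obtain e a where "e \<in> edges H" "a \<in> insert 0 (S e)" "s = (e, a) \<or> s = (e, brk e a)"
      using Ec[of s] by blast
    then show "dslope M' (cutfun H S F wF) s \<in> \<int>" using dsl[of e a] fl(2,3)[of e a] by auto
  qed
  have gnz: "aff H S' (-{0}) g" unfolding g_def
  proof (rule aff_ext[OF wf sd'], fold M'_def)
    fix s assume "s \<in> edges M'"
    then obtain e a where ea: "e \<in> edges H" "a \<in> insert 0 (S e)" and s: "s = (e, a) \<or> s = (e, brk e a)"
      using Ec[of s] by blast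
    show "dslope M' (cutfun H S h wh) s \<in> -{0}"
      using s sg[OF ea] unfolding Compl_iff singleton_iff by (metis dsl[OF ea] less_irrefl)
  qed
  have rf: "rational_fun H f" using rational_fun_model[OF wf] sd' fint by blast
  have nf: "nowhere_flat H g" unfolding nowhere_flat_def using sd' gnz by blast
  have vsub: "p \<in> verts M'" if "p \<in> verts M" for p using vc that by blast
  have dvM: "dv H f p = dsum M floor F p" if p: "p \<in> verts M" for p
  proof -
    have "real_of_int (dv H f p) = dsum M' (\<lambda>s. s) (cutfun H S F wF) p"
      using dv_model(1)[OF wf sd' fint] vsub[OF p] dsum_ext[OF wf sd'] unfolding M'_def f_def by metis
    also have "\<dots> = (\<Sum>s\<in>{s\<in>edges M. src M s = p}. real_of_int \<lfloor>dslope M F s\<rfloor>)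
      + (\<Sum>s\<in>{s\<in>edges M. tgt M s = p}. real_of_int \<lfloor>- dslope M F s\<rfloor>)"
      unfolding node[OF p] using fl(2,3)
      by (intro arg_cong2[of _ _ _ _ "(+)"] sum.cong) (auto simp: E d_def ceiling_def split: prod.splits)
    also have "\<dots> = real_of_int (dsum M floor F p)" by (simp add: dsum_def)
    finally show ?thesis by (simp only: of_int_eq_iff)
  qed
  have dvC: "dv H f (Inner e (brk e a)) = \<lceil>d e a\<rceil> - \<lfloor>d e a\<rfloor>" if ea: "e \<in> edges H" "a \<in> insert 0 (S e)" for e a
  proof -
    have "Inner e (brk e a) \<in> verts M'" using vc ea by blast
    then have "real_of_int (dv H f (Inner e (brk e a))) = dsum M' (\<lambda>s. s) (cutfun H S F wF) (Inner e (brk e a))"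
      using dv_model(1)[OF wf sd' fint] dsum_ext[OF wf sd'] unfolding M'_def f_def by metis
    also have "\<dots> = real_of_int (\<lceil>d e a\<rceil> - \<lfloor>d e a\<rfloor>)" unfolding cutn[OF ea] fl(2,3)[OF ea] by simp
    finally show ?thesis by (simp only: of_int_eq_iff)
  qed
  have dvO: "dv H f p = 0" "moderator H g p = 0" if "p \<notin> verts M'" for p
    using dv_model(2)[OF wf sd' fint] moderator_model(2)[OF wf sd' gnz] that unfolding M'_def by auto
  have modM: "?C h p - 1 \<le> moderator H g p" if p: "p \<in> verts M" for p
  proof -
    have "moderator H g p + 1 = dsum M' neg (cutfun H S h wh) p"
      using moderator_model(1)[OF wf sd' gnz] vsub[OF p] dsum_ext[OF wf sd', of neg] unfolding M'_def g_def
      by (metis diff_add_cancel)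
    moreover have "?C h p \<le> dsum M' neg (cutfun H S h wh) p"
      unfolding node[OF p]
    proof (intro add_mono sum_mono)
      fix s assume "s \<in> {s\<in>edges M. src M s = p}"
      moreover obtain e a where s: "s = (e, a)" by force
      ultimately have ea: "e \<in> edges H" "a \<in> insert 0 (S e)" and p: "p = pt H e a" using E
        by (auto simp: M_def model_simps)
      show "(if dslope M F s \<in> \<int> \<and> h (tgt M s) < h p then 1 else 0)
          \<le> (case s of (e, a) \<Rightarrow> neg ((wh e a - h (pt H e a)) / (brk e a - a)))"
        using sg(1)[OF ea] unfolding s p by (auto simp: neg_def flat_def d_def M_def model_simps)
    next
      fix s assume "s \<in> {s\<in>edges M. tgt M s = p}"
      moreover obtain e a where s: "s = (e, a)" by force
      ultimately have ea: "e \<in> edges H" "a \<in> insert 0 (S e)" and p: "p = pt H e (nxt H S e a)" using E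
        by (auto simp: M_def model_simps)
      show "(if dslope M F s \<in> \<int> \<and> h (src M s) < h p then 1 else 0)
          \<le> (case s of (e, a) \<Rightarrow> neg (- ((h (pt H e (nxt H S e a)) - wh e a) / (nxt H S e a - brk e a))))"
        using sg(3)[OF ea] unfolding s p by (auto simp: neg_def flat_def d_def M_def model_simps)
    qed
    ultimately show ?thesis by linarith
  qed
  \<comment> \<open>On a flat segment \<open>f\<close> does not bend and one direction descends, so
    both sides are 0. Otherwise both directions descend, and the moderator is 1, while the bend is
    worth at most 1.\<close>
  have modC: "\<lceil>d e a\<rceil> - \<lfloor>d e a\<rfloor> \<le> moderator H g (Inner e (brk e a))" if ea: "e \<in> edges H" "a \<in> insert 0 (S e)" for e a
  proof -
    have "Inner e (brk e a) \<in> verts M'" using vc ea by blast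
    then have m: "moderator H g (Inner e (brk e a)) + 1 = dsum M' neg (cutfun H S h wh) (Inner e (brk e a))"
      using moderator_model(1)[OF wf sd' gnz] dsum_ext[OF wf sd', of neg] unfolding M'_def g_def
      by (metis diff_add_cancel)
    have "\<lceil>d e a\<rceil> - \<lfloor>d e a\<rfloor> + 1 \<le> dsum M' neg (cutfun H S h wh) (Inner e (brk e a))"
    proof (cases "flat e a")
      case True
      then have "\<lceil>d e a\<rceil> = \<lfloor>d e a\<rfloor>" by (auto simp: flat_def elim!: Ints_cases)
      moreover have "h (pt H e a) < h (pt H e (nxt H S e a)) \<or> h (pt H e (nxt H S e a)) < h (pt H e a)"
        using ne[OF ea True] by linarith
      ultimately show ?thesis unfolding cutn[OF ea] neg_def neg_less_0_iff_less sg[OF ea] using True by auto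
    next
      case False
      have "\<lceil>d e a\<rceil> - \<lfloor>d e a\<rfloor> \<le> 1" by linarith
      then show ?thesis unfolding cutn[OF ea] neg_def neg_less_0_iff_less sg[OF ea] using False by auto
    qed
    then show ?thesis using m by linarith
  qed
  \<comment> \<open>The emptiness of \<open>R(D)\<close> enters here: with enough chips at
    \<open>v0\<close> as well, \<open>f\<close> would be a section, because all bends contribute
    nonnegatively.\<close>
  have v0neg: "dsum M floor F v0 + D v0 < 0"
  proof (rule ccontr)
    assume a: "\<not> dsum M floor F v0 + D v0 < 0"
    have "0 \<le> dv H f p + D p" for p
    proof -
      consider "p \<in> verts M" | e a where "e \<in> edges H" "a \<in> insert 0 (S e)" "p = Inner e (brk e a)" "p \<notin> verts M"
        | "p \<notin> verts M'" using vc by blast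
      then show ?thesis
      proof cases
        case 1
        then show ?thesis using dvM[OF 1] subharmD[OF F, of p] a by (cases "p = v0") auto
      next
        case (2 e a)
        have "\<lfloor>d e a\<rfloor> \<le> \<lceil>d e a\<rceil>" by linarith
        then show ?thesis using dvC[OF 2(1,2)] Dz[OF 2(4)] 2(3) by simp
      next
        case 3
        then have "D p = 0" using Dz[of p] vsub[of p] by blast
        then show ?thesis using dvO(1)[OF 3] by simp
      qed
    qed
    then have "f \<in> RR H D" using RR_dv[OF wf] rf by blast
    then show False using R by auto
  qed
  have C0: "0 \<le> ?C h p" for p by (intro add_nonneg_nonneg sum_nonneg) auto
  have "D p + dv H f p \<le> moderator H g p" for p
  proof -
    consider "p \<in> verts M" | e a where "e \<in> edges H" "a \<in> insert 0 (S e)" "p = Inner e (brk e a)" "p \<notin> verts M"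
      | "p \<notin> verts M'" using vc by blast
    then show ?thesis
    proof cases
      case 1
      \<comment> \<open>The strict inequality of the burning order supplies the \<open>-1\<close> of
        the moderator. At \<open>v0\<close> the left side is at most \<open>-1\<close> and the count
        is nonnegative.\<close>
      have "dsum M floor F p + D p \<le> ?C h p - 1"
        using burn[of p] v0neg C0[of v0] 1 by (cases "p = v0") auto
      then show ?thesis using modM[OF 1] dvM[OF 1] by linarith
    next
      case (2 e a)
      then show ?thesis using dvC[OF 2(1,2)] modC[OF 2(1,2)] Dz[OF 2(4)] by simp
    next
      case 3
      then have "D p = 0" using Dz[of p] vsub[of p] by blast
      then show ?thesis using dvO[OF 3] by simp
    qed
  qed
  then show ?thesis using that rf nf by blast
qed

section \<open>Riemann--Roch for pure curves\<close>

definition defect :: "('v, 'e) mgraph \<Rightarrow> ('v, 'e) divisor \<Rightarrow> (('v, 'e) point \<Rightarrow> real) \<Rightarrow> (('v, 'e) point \<Rightarrow> real)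
    \<Rightarrow> ('v, 'e) divisor" where
  "defect H D f h p = D p + dv H f p - moderator H h p"

lemma defect_divisor:
  assumes "wf_mgraph H" "is_divisor H D" "rational_fun H f" "nowhere_flat H h"
  shows "is_divisor H (defect H D f h)"
    "deg (defect H D f h) = deg D - (int (card (edges H)) - int (card (verts H)))"
proof -
  have 1: "is_divisor H (\<lambda>p. D p + dv H f p)" "deg (\<lambda>p. D p + dv H f p) = deg D"
    using deg_lin[OF assms(2) dv_divisor(1)[OF assms(1,3)], of 1] dv_divisor(2)[OF assms(1,3)] by simp_all
  show "is_divisor H (defect H D f h)"
    "deg (defect H D f h) = deg D - (int (card (edges H)) - int (card (verts H)))"
    using deg_lin[OF 1(1) moderator_divisor(1)[OF assms(1,4)], of "-1"] moderator_divisor(2)[OF assms(1,4)] 1(2)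
    by (simp_all add: defect_def[abs_def])
qed

definition pos_part :: "('v, 'e) divisor \<Rightarrow> ('v, 'e) divisor" where
  "pos_part X p = max 0 (X p)"

text \<open>The degree formula comes from \<open>X = pos_part X - pos_part (- X)\<close>; it is the
  source of the right-hand side of Riemann--Roch.\<close>

lemma pos_part_divisor:
  assumes "is_divisor H X"
  shows "is_divisor H (pos_part X)" "0 \<le> deg (pos_part X)"
    "deg (pos_part (\<lambda>p. - X p)) = deg (pos_part X) - deg X"
proof -
  have s: "supp (pos_part X) \<subseteq> supp X" "supp (pos_part (\<lambda>p. - X p)) \<subseteq> supp X"
    by (auto simp: supp_def pos_part_def)
  have fin: "finite (supp X)" using assms by (simp add: is_divisor_def)
  show "is_divisor H (pos_part X)" using s(1) fin assms finite_subset unfolding is_divisor_def by blast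
  show "0 \<le> deg (pos_part X)" unfolding deg_def by (intro sum_nonneg) (simp add: pos_part_def)
  have "deg (pos_part X) - deg X = (\<Sum>p\<in>supp X. pos_part X p - X p)"
    using deg_superset[OF fin s(1)] by (simp add: sum_subtractf deg_def)
  also have "\<dots> = deg (pos_part (\<lambda>p. - X p))"
    unfolding deg_superset[OF fin s(2)] by (intro sum.cong) (auto simp: pos_part_def)
  finally show "deg (pos_part (\<lambda>p. - X p)) = deg (pos_part X) - deg X" ..
qed

lemma point_divisor:
  assumes "p0 \<in> points H"
  shows "is_divisor H (\<lambda>p. if p = p0 then 1 else 0)" "deg (\<lambda>p. if p = p0 then 1 else 0) = 1"
proof -
  have "supp (\<lambda>p. if p = p0 then 1 else 0 :: int) = {p0}" by (auto simp: supp_def)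
  then show "is_divisor H (\<lambda>p. if p = p0 then 1 else 0)" "deg (\<lambda>p. if p = p0 then 1 else 0) = 1"
    using assms by (simp_all add: is_divisor_def deg_def)
qed

lemma deg_mono:
  assumes "is_divisor H D" "is_divisor H E" "\<And>p. D p \<le> E p"
  shows "deg D \<le> deg E"
proof -
  have fin: "finite (supp D \<union> supp E)" using assms by (auto simp: is_divisor_def)
  show ?thesis using deg_superset[OF fin, of D] deg_superset[OF fin, of E] assms(3) by (simp add: sum_mono)
qed

definition rank_ge :: "('v, 'e) mgraph \<Rightarrow> ('v, 'e) divisor \<Rightarrow> nat \<Rightarrow> bool" where
  "rank_ge H D k \<longleftrightarrow> (\<forall>E. is_divisor H E \<and> effective E \<and> deg E = int k \<longrightarrow> RR H (\<lambda>p. D p - E p) \<noteq> {})"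

text \<open>If \<open>g\<close> lies in \<open>R(D - E)\<close> and \<open>E\<close> dominates the
  defect of \<open>(f, h)\<close>, then \<open>g - f\<close> lies in \<open>R\<close> of the
  moderator, which is empty. Conversely an \<open>E\<close> with \<open>R(D - E)\<close> empty
  dominates some defect, and being effective also its positive part.\<close>

lemma rank_ge_defect:
  assumes wf: "wf_mgraph H" and D: "is_divisor H D"
  shows "rank_ge H D k \<longleftrightarrow>
    (\<forall>f h. rational_fun H f \<and> nowhere_flat H h \<longrightarrow> int k < deg (pos_part (defect H D f h)))"
proof (intro iffI allI impI)
  fix f h assume P: "rank_ge H D k" and fh: "rational_fun H f \<and> nowhere_flat H h"
  let ?X = "defect H D f h"
  have f: "rational_fun H f" and h: "nowhere_flat H h" using fh by auto
  have pX: "is_divisor H (pos_part ?X)" by (rule pos_part_divisor(1)[OF defect_divisor(1)[OF wf D f h]])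
  show "int k < deg (pos_part ?X)"
  proof (rule ccontr)
    assume a: "\<not> int k < deg (pos_part ?X)"
    obtain v where v: "Vtx v \<in> points H" using wf_mgraphD(3)[OF wf] by (auto simp: points_def)
    \<comment> \<open>The test divisor must have degree exactly \<open>k\<close>; the surplus is
      placed at an arbitrary vertex.\<close>
    define c where "c = int k - deg (pos_part ?X)"
    define E where "E = (\<lambda>p. pos_part ?X p + c * (if p = Vtx v then 1 else 0))"
    have c: "0 \<le> c" using a by (simp add: c_def)
    have "is_divisor H E" unfolding E_def by (rule deg_lin(1)[OF pX point_divisor(1)[OF v]])
    moreover have "deg E = int k"
      unfolding E_def deg_lin(2)[OF pX point_divisor(1)[OF v]] point_divisor(2)[OF v] by (simp add: c_def)
    moreover have E: "pos_part ?X p \<le> E p" for p using c by (simp add: E_def)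
    moreover have "effective E" unfolding effective_def E_def using c by (simp add: pos_part_def)
    ultimately have "RR H (\<lambda>p. D p - E p) \<noteq> {}" using P unfolding rank_ge_def by blast
    then obtain g where "g \<in> RR H (\<lambda>p. D p - E p)" by blast
    then have g: "rational_fun H g" "\<And>p. p \<in> points H \<Longrightarrow> 0 \<le> dv H g p + (D p - E p)"
      unfolding RR_dv[OF wf] by simp_all
    note l = rational_lin[OF wf g(1) f, of "-1"]
    have "0 \<le> dv H (\<lambda>p. g p + of_int (-1) * f p) p + moderator H h p" if p: "p \<in> points H" for p
    proof -
      have "?X p \<le> E p" using E[of p] by (simp add: pos_part_def)
      then show ?thesis using g(2)[OF p] unfolding l(2) defect_def by linarith
    qed
    then have "(\<lambda>p. g p + of_int (-1) * f p) \<in> RR H (moderator H h)" unfolding RR_dv[OF wf] using l(1) by blast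
    then show False using RR_moderator_empty[OF wf h] by blast
  qed
next
  assume P: "\<forall>f h. rational_fun H f \<and> nowhere_flat H h \<longrightarrow> int k < deg (pos_part (defect H D f h))"
  show "rank_ge H D k" unfolding rank_ge_def
  proof (intro allI impI notI)
    fix E assume E: "is_divisor H E \<and> effective E \<and> deg E = int k" and R: "RR H (\<lambda>p. D p - E p) = {}"
    have DE: "is_divisor H (\<lambda>p. D p - E p)" using deg_lin(1)[OF D, of E "-1"] E by simp
    obtain f h where fh: "rational_fun H f" "nowhere_flat H h"
      "\<And>p. D p - E p + dv H f p \<le> moderator H h p" using RR_empty_moderator[OF wf DE R] by metis
    have "deg (pos_part (defect H D f h)) \<le> deg E"
    proof (rule deg_mono[OF pos_part_divisor(1)[OF defect_divisor(1)[OF wf D fh(1,2)]]])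
      show "is_divisor H E" using E by blast
      fix p
      have "0 \<le> E p" using E by (simp add: effective_def)
      then show "pos_part (defect H D f h) p \<le> E p" using fh(3)[of p] by (simp add: pos_part_def defect_def)
    qed
    moreover have "int k < deg (pos_part (defect H D f h))" using P fh(1,2) by blast
    ultimately show False using E by linarith
  qed
qed

lemma rank_ge_0:
  assumes D: "is_divisor H D"
  shows "rank_ge H D 0 \<longleftrightarrow> RR H D \<noteq> {}"
proof -
  have "E = (\<lambda>_. 0)" if E: "is_divisor H E" "effective E" "deg E = 0" for E
  proof
    fix p
    have "\<forall>p\<in>supp E. E p = 0"
      using E sum_nonneg_eq_0_iff[of "supp E" E] by (auto simp: is_divisor_def effective_def deg_def)
    then show "E p = 0" by (auto simp: supp_def)
  qed
  moreover have "is_divisor H (\<lambda>_. 0)" "effective (\<lambda>_. 0)" "deg (\<lambda>_. 0) = 0"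
    by (simp_all add: is_divisor_def supp_def effective_def deg_def)
  ultimately show ?thesis unfolding rank_ge_def by fastforce
qed

text \<open>\<open>rank_ge H D k\<close> holds exactly for \<open>k < n\<close>, so
  \<open>GREATEST\<close> is attained at \<open>n - 1\<close>. For \<open>n = 0\<close> no
  \<open>k\<close> is left, and this is the case where the rank is set to \<open>-1\<close>.\<close>

lemma rank_defect:
  assumes wf: "wf_mgraph H" and D: "is_divisor H D"
    and le: "\<And>f h. rational_fun H f \<Longrightarrow> nowhere_flat H h \<Longrightarrow> int n \<le> deg (pos_part (defect H D f h))"
    and eq: "rational_fun H f0" "nowhere_flat H h0" "deg (pos_part (defect H D f0 h0)) = int n"
  shows "rank H D = int n - 1"
proof -
  have P: "rank_ge H D k \<longleftrightarrow> k < n" for k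
    unfolding rank_ge_defect[OF wf D] using le eq by (metis of_nat_less_iff order_less_le_trans)
  show ?thesis
  proof (cases "n = 0")
    case True
    then have "RR H D = {}" using P[of 0] rank_ge_0[OF D] by blast
    then show ?thesis using True by (simp add: rank_def)
  next
    case False
    then have "RR H D \<noteq> {}" using P[of 0] rank_ge_0[OF D] by blast
    then have "rank H D = int (GREATEST k. rank_ge H D k)" by (simp add: rank_def rank_ge_def)
    also have "(GREATEST k. rank_ge H D k) = n - 1"
      unfolding P using False by (intro Greatest_equality) auto
    finally show ?thesis using False by simp
  qed
qed

lemma canonical_divisor:
  assumes "wf_mgraph H" shows "is_divisor H (canonical H w)"
proof -
  have "p \<in> Vtx ` verts H" if "p \<in> supp (canonical H w)" for p
    using that by (cases p) (auto simp: supp_def canonical_def split: if_splits)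
  then have "supp (canonical H w) \<subseteq> Vtx ` verts H" by blast
  then show ?thesis using wf_mgraphD(1)[OF assms] finite_subset[of _ "Vtx ` verts H"]
    by (auto simp: is_divisor_def points_def)
qed

text \<open>Since the moderator of \<open>- h\<close> is \<open>K\<close> minus that of
  \<open>h\<close>, passing to \<open>K - D\<close>, \<open>- f\<close>, \<open>- h\<close> negates
  the defect.\<close>

lemma defect_dual:
  assumes wf: "wf_mgraph H" and D: "is_divisor H D" and f: "rational_fun H f" and h: "nowhere_flat H h"
  shows "rational_fun H (\<lambda>p. - f p)"
    "deg (pos_part (defect H (\<lambda>p. canonical H (\<lambda>_. 0) p - D p) (\<lambda>p. - f p) (\<lambda>p. - h p)))
       = deg (pos_part (defect H D f h)) - (deg D - (int (card (edges H)) - int (card (verts H))))"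
proof -
  \<comment> \<open>\<open>rational_lin\<close> provides \<open>f + k * g\<close> with integral
    \<open>k\<close>; the choice \<open>g = f\<close>, \<open>k = -2\<close> yields
    \<open>- f\<close>.\<close>
  have e: "(\<lambda>p. f p + of_int (- 2) * f p) = (\<lambda>p. - f p)" by auto
  note l = rational_lin[OF wf f f, of "-2"]
  show "rational_fun H (\<lambda>p. - f p)" using l(1) unfolding e .
  have dv: "dv H (\<lambda>p. - f p) = (\<lambda>p. - dv H f p)" using l(2) unfolding e by simp
  have "defect H (\<lambda>p. canonical H (\<lambda>_. 0) p - D p) (\<lambda>p. - f p) (\<lambda>p. - h p) = (\<lambda>p. - defect H D f h p)"
    unfolding defect_def[abs_def] dv moderator_uminus(2)[OF wf h] by auto
  then show "deg (pos_part (defect H (\<lambda>p. canonical H (\<lambda>_. 0) p - D p) (\<lambda>p. - f p) (\<lambda>p. - h p)))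
       = deg (pos_part (defect H D f h)) - (deg D - (int (card (edges H)) - int (card (verts H))))"
    using pos_part_divisor(3)[OF defect_divisor(1)[OF assms]] defect_divisor(2)[OF assms] by simp
qed

lemma riemann_roch_pure:
  assumes wf: "wf_mgraph H" and D: "is_divisor H D"
  shows "rank H D - rank H (\<lambda>p. canonical H (\<lambda>_. 0) p - D p)
    = deg D - (int (card (edges H)) - int (card (verts H)))"
proof -
  let ?K = "canonical H (\<lambda>_. 0)" and ?c = "deg D - (int (card (edges H)) - int (card (verts H)))"
  let ?m = "\<lambda>D f h. deg (pos_part (defect H D f h))"
  have DK: "is_divisor H (\<lambda>p. ?K p - D p)"
    using deg_lin(1)[OF canonical_divisor[OF wf] D, of _ "-1"] by simp
  \<comment> \<open>The minimum needs at least one pair. A divisor of degree \<open>-1\<close> has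
    no sections, so \<open>RR_empty_moderator\<close> applied to it produces one.\<close>
  have "\<exists>f h. rational_fun H f \<and> nowhere_flat H h"
  proof -
    obtain v where v: "Vtx v \<in> points H" using wf_mgraphD(3)[OF wf] by (auto simp: points_def)
    define N :: "('a, 'b) divisor" where "N = (\<lambda>p. 0 + (-1) * (if p = Vtx v then 1 else 0))"
    have 0: "is_divisor H (\<lambda>_. 0)" "deg (\<lambda>_::('a, 'b) point. 0) = 0" by (simp_all add: is_divisor_def supp_def deg_def)
    have N: "is_divisor H N" "deg N = -1"
      unfolding N_def using deg_lin[OF 0(1) point_divisor(1)[OF v], of "-1"] 0(2) point_divisor(2)[OF v] by simp_all
    have "g \<notin> RR H N" for g
    proof
      assume "g \<in> RR H N"
      then have g: "rational_fun H g" "\<And>p. p \<in> points H \<Longrightarrow> 0 \<le> dv H g p + N p" using RR_dv[OF wf] by blast+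
      have "0 \<le> dv H g p + 1 * N p" for p
        using g(2)[of p] v by (cases "p \<in> points H") (auto simp: N_def dv_def)
      from deg_mono[OF 0(1) deg_lin(1)[OF dv_divisor(1)[OF wf g(1)] N(1)] this]
      show False using deg_lin(2)[OF dv_divisor(1)[OF wf g(1)] N(1), of 1] dv_divisor(2)[OF wf g(1)] N(2) 0(2) by simp
    qed
    then have "RR H N = {}" by blast
    from RR_empty_moderator[OF wf N(1) this] show ?thesis by blast
  qed
  then obtain f1 h1 where "case (f1, h1) of (f, h) \<Rightarrow> rational_fun H f \<and> nowhere_flat H h" by auto
  from ex_has_least_nat[of "\<lambda>(f, h). rational_fun H f \<and> nowhere_flat H h", OF this, of "\<lambda>(f, h). nat (?m D f h)"]
  obtain f0 h0 where fh0: "rational_fun H f0" "nowhere_flat H h0"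
    and min: "\<And>f h. rational_fun H f \<Longrightarrow> nowhere_flat H h \<Longrightarrow> nat (?m D f0 h0) \<le> nat (?m D f h)"
    by (auto simp: case_prod_unfold)
  have ge0: "0 \<le> ?m D f h" if "is_divisor H D" "rational_fun H f" "nowhere_flat H h" for D f h
    using pos_part_divisor(2)[OF defect_divisor(1)[OF wf that]] .
  define n where "n = nat (?m D f0 h0)"
  have n: "?m D f0 h0 = int n" using ge0[OF D fh0] by (simp add: n_def)
  have le: "int n \<le> ?m D f h" if "rational_fun H f" "nowhere_flat H h" for f h
    using min[OF that] ge0[OF D that] unfolding n_def by linarith
  have r1: "rank H D = int n - 1" by (rule rank_defect[OF wf D le fh0 n])
  note fh0' = defect_dual(1)[OF wf D fh0] moderator_uminus(1)[OF wf fh0(2)]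
  have n2: "?m (\<lambda>p. ?K p - D p) (\<lambda>p. - f0 p) (\<lambda>p. - h0 p) = int n - ?c"
    using defect_dual(2)[OF wf D fh0] n by simp
  then have c: "?c \<le> int n" using ge0[OF DK fh0'] by simp
  \<comment> \<open>Negation is an involution, so \<open>(f, h)\<close> is the dual of
    \<open>(- f, - h)\<close> and the lower bound for \<open>D\<close> carries over. The truncation
    by \<open>nat\<close> is harmless, as \<open>int n - ?c\<close> is the degree of a positive
    part.\<close>
  have "int (nat (int n - ?c)) \<le> ?m (\<lambda>p. ?K p - D p) f h" if fh: "rational_fun H f" "nowhere_flat H h" for f h
  proof -
    have f': "rational_fun H (\<lambda>p. - f p)" "nowhere_flat H (\<lambda>p. - h p)"
      using defect_dual(1)[OF wf D fh] moderator_uminus(1)[OF wf fh(2)] .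
    show ?thesis using defect_dual(2)[OF wf D f'] le[OF f'] c by simp
  qed
  from rank_defect[OF wf DK this fh0'] have "rank H (\<lambda>p. ?K p - D p) = int (nat (int n - ?c)) - 1"
    using n2 c by simp
  then show ?thesis using r1 c by simp
qed

section \<open>Weighted curves\<close>

lemma pure_curve_simps:
  "verts (pure_curve G \<omega> \<epsilon>) = verts G"
  "edges (pure_curve G \<omega> \<epsilon>) = Inl ` edges G \<union> Inr ` (SIGMA v:verts G. {..<\<omega> v})"
  "src (pure_curve G \<omega> \<epsilon>) = case_sum (src G) fst"
  "tgt (pure_curve G \<omega> \<epsilon>) = case_sum (tgt G) fst"
  "len (pure_curve G \<omega> \<epsilon>) = case_sum (len G) (\<lambda>_. \<epsilon>)"
  by (auto simp: pure_curve_def)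

lemma wf_pure_curve:
  assumes "wf_mgraph G" "0 < \<epsilon>"
  shows "wf_mgraph (pure_curve G \<omega> \<epsilon>)"
proof -
  note w = wf_mgraphD[OF assms(1)]
  have "adj_rel G \<subseteq> adj_rel (pure_curve G \<omega> \<epsilon>)"
    unfolding adj_rel_def pure_curve_simps by force
  then have "(u, v) \<in> (adj_rel (pure_curve G \<omega> \<epsilon>))\<^sup>*" if "u \<in> verts G" "v \<in> verts G" for u v
    using assms(1) that rtrancl_mono[of "adj_rel G" "adj_rel (pure_curve G \<omega> \<epsilon>)"] unfolding wf_mgraph_def by blast
  then show ?thesis unfolding wf_mgraph_def pure_curve_simps using w assms(2) by auto
qed

lemma card_pure_curve:
  assumes "wf_mgraph G"
  shows "int (card (edges (pure_curve G \<omega> \<epsilon>))) - int (card (verts (pure_curve G \<omega> \<epsilon>))) = genus G \<omega> - 1"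
proof -
  note w = wf_mgraphD[OF assms]
  have "card (edges (pure_curve G \<omega> \<epsilon>)) = card (Inl ` edges G :: ('b + 'a \<times> nat) set) + card (Inr ` (SIGMA v:verts G. {..<\<omega> v}) :: ('b + 'a \<times> nat) set)"
    unfolding pure_curve_simps using w(1,2) by (intro card_Un_disjoint) auto
  also have "\<dots> = card (edges G) + (\<Sum>v\<in>verts G. \<omega> v)"
    using w(1) by (simp add: card_image)
  finally show ?thesis by (simp add: genus_def pure_curve_simps)
qed

text \<open>Each attached loop raises the valency by two, which is the term
  \<open>2 * \<omega> v\<close> of the weighted canonical divisor.\<close>

lemma canonical_pure_curve:
  assumes "wf_mgraph G"
  shows "canonical (pure_curve G \<omega> \<epsilon>) (\<lambda>_. 0) = iota (canonical G \<omega>)"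
proof
  fix p :: "('a, 'b + 'a \<times> nat) point"
  note w = wf_mgraphD[OF assms]
  show "canonical (pure_curve G \<omega> \<epsilon>) (\<lambda>_. 0) p = iota (canonical G \<omega>) p"
  proof (cases p)
    case (Vtx v)
    have "val (pure_curve G \<omega> \<epsilon>) v = val G v + 2 * \<omega> v" if v: "v \<in> verts G"
    proof -
      let ?L = "Inr ` ({v} \<times> {..<\<omega> v}) :: ('b + 'a \<times> nat) set"
      have L: "card ?L = \<omega> v" by (simp add: card_image card_cartesian_product)
      have "{e\<in>edges (pure_curve G \<omega> \<epsilon>). src (pure_curve G \<omega> \<epsilon>) e = v} = Inl ` {e\<in>edges G. src G e = v} \<union> ?L"
        "{e\<in>edges (pure_curve G \<omega> \<epsilon>). tgt (pure_curve G \<omega> \<epsilon>) e = v} = Inl ` {e\<in>edges G. tgt G e = v} \<union> ?L"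
        using v by (auto simp: pure_curve_simps)
      moreover have "card (Inl ` A \<union> ?L) = card A + \<omega> v" if "finite A" for A :: "'b set"
        using that L by (subst card_Un_disjoint) (auto simp: card_image)
      ultimately show ?thesis using w(2) by (simp add: val_def)
    qed
    then show ?thesis using Vtx by (simp add: canonical_def iota_def pure_curve_simps)
  next
    case (Inner e t)
    then show ?thesis by (simp add: canonical_def iota_def split: sum.split)
  qed
qed

lemma iota_divisor:
  assumes D: "is_divisor G D"
  shows "is_divisor (pure_curve G \<omega> \<epsilon>) (iota D)"
    "deg (iota D :: ('v, 'e + 'v \<times> nat) divisor) = deg D"
proof -
  define j :: "('v, 'e) point \<Rightarrow> ('v, 'e + 'v \<times> nat) point" where
    "j = (\<lambda>p. case p of Vtx v \<Rightarrow> Vtx v | Inner e t \<Rightarrow> Inner (Inl e) t)"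
  have inj: "inj j" by (auto simp: inj_def j_def split: point.splits)
  have ij: "iota D (j p) = D p" for p by (simp add: iota_def j_def split: point.split)
  have "q \<in> range j" if nz: "iota D q \<noteq> 0" for q
  proof (cases q)
    case (Vtx v) then show ?thesis by (intro range_eqI[of _ _ "Vtx v"]) (simp add: j_def)
  next
    case (Inner e t)
    then obtain e' where "e = Inl e'" using nz by (cases e) (auto simp: iota_def)
    then show ?thesis using Inner by (intro range_eqI[of _ _ "Inner e' t"]) (simp add: j_def)
  qed
  then have s: "supp (iota D) = j ` supp D" using ij unfolding supp_def by fastforce
  have "j p \<in> points (pure_curve G \<omega> \<epsilon>)" if "p \<in> points G" for p
    using that by (auto simp: points_def j_def pure_curve_simps)
  then show "is_divisor (pure_curve G \<omega> \<epsilon>) (iota D)" using D s by (auto simp: is_divisor_def)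
  show "deg (iota D :: ('v, 'e + 'v \<times> nat) divisor) = deg D"
    unfolding deg_def s using inj ij by (subst sum.reindex) (auto intro: inj_on_subset)
qed

text \<open>Independence of \<open>\<epsilon>\<close>: a function on the loops of length \<open>\<epsilon>1\<close> is transported to the loops of length
  \<open>\<epsilon>2 = \<epsilon>1 / c\<close> by stretching both the argument and the value, so that the slopes do not change.\<close>
definition stretch :: "real \<Rightarrow> ('v, 'e + 'x) point \<Rightarrow> ('v, 'e + 'x) point" where
  "stretch c p = (case p of Inner (Inr x) t \<Rightarrow> Inner (Inr x) (c * t) | _ \<Rightarrow> p)"

lemma stretch_stretch: "c \<noteq> 0 \<Longrightarrow> stretch (1 / c) (stretch c p) = p" "c \<noteq> 0 \<Longrightarrow> stretch c (stretch (1 / c) p) = p"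
  by (auto simp: stretch_def split: point.split sum.split)

text \<open>The values on a loop are scaled about the value at its base vertex, which therefore does
  not change; this keeps the function continuous where the loop is attached.\<close>

definition stretch_fun :: "real \<Rightarrow> (('v, 'e + 'v \<times> nat) point \<Rightarrow> real) \<Rightarrow> ('v, 'e + 'v \<times> nat) point \<Rightarrow> real" where
  "stretch_fun c f p = (case p of
      Inner (Inr x) t \<Rightarrow> f (Vtx (fst x)) + (f (Inner (Inr x) (c * t)) - f (Vtx (fst x))) / c
    | _ \<Rightarrow> f p)"

lemma filtermap_times_pos_at_left:
  fixes c :: real assumes "0 < c"
  shows "filtermap (times c) (at_left p) = at_left (c * p)"
proof -
  have "filtermap (times c) (at_left p) = filtermap uminus (filtermap (times c) (at_right (- p)))"
    by (simp add: at_left_minus filtermap_filtermap)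
  then show ?thesis by (simp add: filtermap_times_pos_at_right[OF assms] at_left_minus[of "c * p"])
qed

text \<open>Scaling argument and value by the same factor carries one difference quotient into the
  other. Either side has one-sided derivative \<open>s\<close> iff the other has, so the two
  \<open>THE\<close> terms agree for any \<open>\<phi>\<close>.\<close>

lemma slope_stretch:
  fixes A :: real assumes c: "0 < c"
  shows "rslope (\<lambda>t. A + (\<phi> (c * t) - A) / c) t = rslope \<phi> (c * t)"
    "lslope (\<lambda>t. A + (\<phi> (c * t) - A) / c) t = lslope \<phi> (c * t)"
proof -
  have q: "(\<lambda>y. (A + (\<phi> (c * y) - A) / c - (A + (\<phi> (c * t) - A) / c)) / (y - t))
      = (\<lambda>y. (\<lambda>z. (\<phi> z - \<phi> (c * t)) / (z - c * t)) (c * y))"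
  proof
    fix y
    have "(A + (\<phi> (c * y) - A) / c - (A + (\<phi> (c * t) - A) / c)) = (\<phi> (c * y) - \<phi> (c * t)) / c"
      by (simp add: diff_divide_distrib)
    then show "(A + (\<phi> (c * y) - A) / c - (A + (\<phi> (c * t) - A) / c)) / (y - t)
        = (\<lambda>z. (\<phi> z - \<phi> (c * t)) / (z - c * t)) (c * y)" by (simp add: right_diff_distrib)
  qed
  have lim: "((\<lambda>y. Q (c * y)) \<longlongrightarrow> s) (at_right t) \<longleftrightarrow> (Q \<longlongrightarrow> s) (at_right (c * t))"
    "((\<lambda>y. Q (c * y)) \<longlongrightarrow> s) (at_left t) \<longleftrightarrow> (Q \<longlongrightarrow> s) (at_left (c * t))" for Q :: "real \<Rightarrow> real" and s
    unfolding filtermap_times_pos_at_right[OF c, symmetric] filtermap_times_pos_at_left[OF c, symmetric]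
      filterlim_filtermap by (rule refl)+
  have "((\<lambda>t. A + (\<phi> (c * t) - A) / c) has_real_derivative s) (at_right t) \<longleftrightarrow> (\<phi> has_real_derivative s) (at_right (c * t))"
    and "((\<lambda>t. A + (\<phi> (c * t) - A) / c) has_real_derivative s) (at_left t) \<longleftrightarrow> (\<phi> has_real_derivative s) (at_left (c * t))" for s
    unfolding has_field_derivative_iff q by (rule lim)+
  then show "rslope (\<lambda>t. A + (\<phi> (c * t) - A) / c) t = rslope \<phi> (c * t)"
    "lslope (\<lambda>t. A + (\<phi> (c * t) - A) / c) t = lslope \<phi> (c * t)"
    by (simp_all add: rslope_def lslope_def)
qed

lemma pw_affine_int_stretch:
  assumes c: "0 < c" and \<phi>: "pw_affine_int \<phi> 0 (c * b)"
  shows "pw_affine_int (\<lambda>t. A + (\<phi> (c * t) - A) / c) 0 b"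
proof -
  obtain n x where x: "x 0 = 0" "x n = c * b" "\<forall>i<n. x i < x (Suc i)"
    and s: "\<And>i. i < n \<Longrightarrow> \<exists>s::int. \<forall>t\<in>{x i..x (Suc i)}. \<phi> t = \<phi> (x i) + of_int s * (t - x i)"
    using \<phi> unfolding pw_affine_int_def by blast
  have "\<exists>s::int. \<forall>t\<in>{x i / c..x (Suc i) / c}. A + (\<phi> (c * t) - A) / c
      = A + (\<phi> (c * (x i / c)) - A) / c + of_int s * (t - x i / c)" if i: "i < n" for i
  proof -
    obtain s' :: int where s': "\<And>t. t \<in> {x i..x (Suc i)} \<Longrightarrow> \<phi> t = \<phi> (x i) + of_int s' * (t - x i)"
      using s[OF i] by blast
    have "A + (\<phi> (c * t) - A) / c = A + (\<phi> (c * (x i / c)) - A) / c + of_int s' * (t - x i / c)"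
      if t: "t \<in> {x i / c..x (Suc i) / c}" for t
    proof -
      have "c * t \<in> {x i..x (Suc i)}" using t c by (simp add: divide_le_eq le_divide_eq mult.commute)
      from s'[OF this] have "\<phi> (c * t) - A = (\<phi> (x i) - A) + of_int s' * (c * t - x i)" by linarith
      then have "(\<phi> (c * t) - A) / c = (\<phi> (x i) - A) / c + of_int s' * (c * t - x i) / c"
        by (simp only: add_divide_distrib)
      also have "of_int s' * (c * t - x i) / c = of_int s' * (t - x i / c)" using c by (simp add: field_simps)
      finally show ?thesis using c by simp
    qed
    then show ?thesis by blast
  qed
  then show ?thesis unfolding pw_affine_int_def using x c
    by (intro exI[of _ n] exI[of _ "\<lambda>i. x i / c"]) (simp add: divide_strict_right_mono)
qed

lemma stretch_points:
  assumes \<epsilon>: "0 < \<epsilon>1" "0 < \<epsilon>2" and p: "p \<in> points (pure_curve G \<omega> \<epsilon>2)"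
  shows "stretch (\<epsilon>1 / \<epsilon>2) p \<in> points (pure_curve G \<omega> \<epsilon>1)"
proof (cases p)
  case (Vtx v) then show ?thesis using p by (auto simp: points_def stretch_def pure_curve_simps)
next
  case (Inner e t)
  show ?thesis
  proof (cases e)
    case (Inl a) then show ?thesis using p Inner by (auto simp: points_def stretch_def pure_curve_simps)
  next
    case (Inr x)
    then have "Inr x \<in> edges (pure_curve G \<omega> \<epsilon>1)" "0 < t" "t < \<epsilon>2"
      using p Inner by (auto simp: points_def pure_curve_simps)
    moreover have "0 < \<epsilon>1 / \<epsilon>2 * t" "\<epsilon>1 / \<epsilon>2 * t < \<epsilon>1" using \<epsilon> calculation by (simp_all add: field_simps)
    ultimately show ?thesis using Inner Inr by (simp add: points_def stretch_def) (simp add: pure_curve_simps)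
  qed
qed

lemma RR_stretch:
  fixes G :: "('v, 'e) mgraph"
  assumes wf: "wf_mgraph G" and \<epsilon>: "0 < \<epsilon>1" "0 < \<epsilon>2" and f: "f \<in> RR (pure_curve G \<omega> \<epsilon>1) X"
  shows "stretch_fun (\<epsilon>1 / \<epsilon>2) f \<in> RR (pure_curve G \<omega> \<epsilon>2) (\<lambda>p. X (stretch (\<epsilon>1 / \<epsilon>2) p))"
proof -
  define c where "c = \<epsilon>1 / \<epsilon>2"
  let ?H1 = "pure_curve G \<omega> \<epsilon>1" and ?H2 = "pure_curve G \<omega> \<epsilon>2" and ?g = "stretch_fun c f"
  have c: "0 < c" and c2: "c * \<epsilon>2 = \<epsilon>1" using \<epsilon> by (simp_all add: c_def)
  have cl: "\<epsilon>1 \<le> c * t \<longleftrightarrow> \<epsilon>2 \<le> t" for t using c unfolding c2[symmetric] by simp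
  have c0: "c * t \<le> 0 \<longleftrightarrow> t \<le> 0" for t using c by (simp add: mult_le_0_iff)
  have e1: "edge_fun ?H2 ?g (Inl e) = edge_fun ?H1 f (Inl e)" for e
    by (auto simp: edge_fun_def stretch_fun_def pure_curve_simps)
  have e2: "edge_fun ?H2 ?g (Inr x) = (\<lambda>t. f (Vtx (fst x)) + (edge_fun ?H1 f (Inr x) (c * t) - f (Vtx (fst x))) / c)" for x
    by (rule ext) (simp add: edge_fun_def stretch_fun_def pure_curve_simps cl c0)
  have E: "edges ?H2 = edges ?H1" by (simp add: pure_curve_simps)
  have rf1: "rational_fun ?H1 f" and ordf: "\<And>p. p \<in> points ?H1 \<Longrightarrow> 0 \<le> ord ?H1 f p + of_int (X p)"
    using f by (auto simp: RR_def)
  have "rational_fun ?H2 ?g"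
    unfolding rational_fun_def
  proof
    fix e assume "e \<in> edges ?H2"
    then have *: "pw_affine_int (edge_fun ?H1 f e) 0 (len ?H1 e)" using rf1 E unfolding rational_fun_def by auto
    show "pw_affine_int (edge_fun ?H2 ?g e) 0 (len ?H2 e)"
    proof (cases e)
      case (Inl a) then show ?thesis using * e1 by (simp add: pure_curve_simps)
    next
      case (Inr x)
      then have "pw_affine_int (edge_fun ?H1 f (Inr x)) 0 (c * \<epsilon>2)" using * c2 by (simp add: pure_curve_simps)
      from pw_affine_int_stretch[OF c this] show ?thesis unfolding Inr e2 by (simp add: pure_curve_simps)
    qed
  qed
  moreover have "0 \<le> ord ?H2 ?g p + of_int (X (stretch c p))" if p: "p \<in> points ?H2" for p
  proof -
    have "stretch c p \<in> points ?H1" unfolding c_def by (rule stretch_points[OF \<epsilon> p])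
    moreover have "ord ?H2 ?g p = ord ?H1 f (stretch c p)"
    proof (cases p)
      case (Inner e t)
      then show ?thesis using e1 e2 slope_stretch[OF c] by (cases e) (simp_all add: ord_def stretch_def)
    next
      case (Vtx v)
      have r: "rslope (edge_fun ?H2 ?g e) 0 = rslope (edge_fun ?H1 f e) 0" for e
        using slope_stretch(1)[OF c, of _ _ 0] by (cases e) (simp_all add: e1 e2)
      have l: "lslope (edge_fun ?H2 ?g e) (len ?H2 e) = lslope (edge_fun ?H1 f e) (len ?H1 e)" for e
        using slope_stretch(2)[OF c, of _ _ \<epsilon>2] c2 by (cases e) (simp_all add: e1 e2 pure_curve_simps)
      have st: "src ?H2 = src ?H1" "tgt ?H2 = tgt ?H1" by (simp_all add: pure_curve_simps)
      show ?thesis unfolding Vtx ord_def stretch_def point.case r l E st ..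
    qed
    ultimately show ?thesis using ordf[of "stretch c p"] by simp
  qed
  ultimately show ?thesis unfolding RR_def c_def by simp
qed

text \<open>A test divisor \<open>E\<close> may have points inside the loops and has to be carried
  to the other curve, whereas \<open>iota D\<close> vanishes there and is invariant under
  \<open>stretch\<close>.\<close>

lemma rank_ge_stretch:
  assumes wf: "wf_mgraph G" and \<epsilon>: "0 < \<epsilon>1" "0 < \<epsilon>2" and r: "rank_ge (pure_curve G \<omega> \<epsilon>1) (iota D) k"
  shows "rank_ge (pure_curve G \<omega> \<epsilon>2) (iota D) k"
  unfolding rank_ge_def
proof (intro allI impI)
  fix E assume E: "is_divisor (pure_curve G \<omega> \<epsilon>2) E \<and> effective E \<and> deg E = int k"
  define c where "c = \<epsilon>1 / \<epsilon>2"
  have c: "0 < c" using \<epsilon> by (simp add: c_def)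
  define E' where "E' = (\<lambda>p. E (stretch (1 / c) p))"
  have s: "supp E' = stretch c ` supp E"
  proof (rule set_eqI)
    fix q
    have "q \<in> stretch c ` supp E \<longleftrightarrow> stretch (1 / c) q \<in> supp E"
      using stretch_stretch[of c] c by (metis image_iff less_irrefl)
    then show "q \<in> supp E' \<longleftrightarrow> q \<in> stretch c ` supp E" by (simp add: supp_def E'_def)
  qed
  have inj: "inj (stretch c)" using stretch_stretch(1)[of c] c by (intro inj_on_inverseI[of _ "stretch (1 / c)"]) auto
  have "is_divisor (pure_curve G \<omega> \<epsilon>1) E'"
    using E stretch_points[OF \<epsilon>] unfolding is_divisor_def s c_def by blast
  moreover have "effective E'" using E by (simp add: effective_def E'_def)
  moreover have "deg E' = deg E"
    unfolding deg_def s using inj c by (subst sum.reindex) (auto simp: E'_def stretch_stretch intro: inj_on_subset)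
  ultimately have "RR (pure_curve G \<omega> \<epsilon>1) (\<lambda>p. iota D p - E' p) \<noteq> {}" using r E unfolding rank_ge_def by auto
  then obtain f where "f \<in> RR (pure_curve G \<omega> \<epsilon>1) (\<lambda>p. iota D p - E' p)" by blast
  from RR_stretch[OF wf \<epsilon> this, folded c_def]
  have "stretch_fun c f \<in> RR (pure_curve G \<omega> \<epsilon>2) (\<lambda>p. iota D (stretch c p) - E p)"
    using c by (simp add: E'_def stretch_stretch)
  moreover have "iota D (stretch c p) = iota D p" for p
    by (auto simp: iota_def stretch_def split: point.split sum.split)
  ultimately show "RR (pure_curve G \<omega> \<epsilon>2) (\<lambda>p. iota D p - E p) \<noteq> {}" by auto
qed

theorem theorem5p4:
  fixes G :: "('v, 'e) mgraph" and \<omega> :: "'v \<Rightarrow> nat" and D :: "('v, 'e) divisor"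
  assumes "wf_mgraph G" and "is_divisor G D"
  shows "(\<forall>\<epsilon>1 \<epsilon>2. \<epsilon>1 > 0 \<longrightarrow> \<epsilon>2 > 0 \<longrightarrow>
            rank (pure_curve G \<omega> \<epsilon>1) (iota D) = rank (pure_curve G \<omega> \<epsilon>2) (iota D))
       \<and> (\<forall>\<epsilon>>0. rank (pure_curve G \<omega> \<epsilon>) (iota D)
                  - rank (pure_curve G \<omega> \<epsilon>) (iota (\<lambda>p. canonical G \<omega> p - D p))
                = deg D - genus G \<omega> + 1)"
proof (intro conjI allI impI)
  fix \<epsilon>1 \<epsilon>2 :: real assume \<epsilon>: "\<epsilon>1 > 0" "\<epsilon>2 > 0"
  \<comment> \<open>\<open>rank_ge_stretch\<close> is used in both directions, with the two lengths
    exchanged.\<close>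
  have P: "rank_ge (pure_curve G \<omega> \<epsilon>1) (iota D) k \<longleftrightarrow> rank_ge (pure_curve G \<omega> \<epsilon>2) (iota D) k" for k
    using rank_ge_stretch[OF assms(1)] \<epsilon> by blast
  then have "rank_ge (pure_curve G \<omega> \<epsilon>1) (iota D) = rank_ge (pure_curve G \<omega> \<epsilon>2) (iota D)" by (rule ext)
  moreover have "RR (pure_curve G \<omega> \<epsilon>1) (iota D) = {} \<longleftrightarrow> RR (pure_curve G \<omega> \<epsilon>2) (iota D) = {}"
    using P[of 0] rank_ge_0[OF iota_divisor(1)[OF assms(2)]] by blast
  ultimately show "rank (pure_curve G \<omega> \<epsilon>1) (iota D) = rank (pure_curve G \<omega> \<epsilon>2) (iota D)"
    unfolding rank_def rank_ge_def[symmetric] by simp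
next
  fix \<epsilon> :: real assume \<epsilon>: "\<epsilon> > 0"
  have K: "iota (\<lambda>p. canonical G \<omega> p - D p) = (\<lambda>p. canonical (pure_curve G \<omega> \<epsilon>) (\<lambda>_. 0) p - iota D p)"
    unfolding canonical_pure_curve[OF assms(1)] by (rule ext) (simp add: iota_def split: point.split sum.split)
  show "rank (pure_curve G \<omega> \<epsilon>) (iota D) - rank (pure_curve G \<omega> \<epsilon>) (iota (\<lambda>p. canonical G \<omega> p - D p))
      = deg D - genus G \<omega> + 1"
    unfolding K using riemann_roch_pure[OF wf_pure_curve[OF assms(1) \<epsilon>] iota_divisor(1)[OF assms(2)]]
      card_pure_curve[OF assms(1)] iota_divisor(2)[OF assms(2)] by simp
qed

end
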